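(* Let $n\ge 5$ and let $A_n$ be the alternating group of degree $n$. Then the Engel graph $\Gamma(A_n)$ is strongly connected if and only if $n\neq 5$. Moreover: if $n\ge 7$, then $\Gamma_2(A_n)$ is strongly connected; and $\Gamma_3(A_6)$ is strongly connected, but $\Gamma_2(A_6)$ is not strongly connected.
   Context: Commutators: $[a,b]=a^{-1}b^{-1}ab$, $[x,{}_0y]=x$, and $[x,{}_{i+1}y]=[[x,{}_iy],y]$ for $i\ge 0$. For a finite group $G$ with hypercenter $Z_\infty(G)$, the Engel graph $\Gamma(G)$ is the directed graph with vertex set $G\setminus Z_\infty(G)$ and an edge $x\mapsto y$ if and only if $[x,{}_ny]=1$ for some integer $n>0$. For a fixed integer $n\ge 1$, $\Gamma_n(G)$ is the directed graph with an edge $x\mapsto y$ if and only if $[x,{}_ny]=1$, and with vertex set $G\setminus I_n(G)$, where $I_n(G)=\{g\in G\mid [g,{}_nx]=1=[x,{}_ng]\text{ for all }x\in G\}$. A directed graph is strongly connected if for every pair of vertices $(x,y)$ it contains a directed path from $x$ to $y$. *)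

theory Defs
  imports "HOL-Algebra.Sym_Groups" "Graph_Theory.Digraph_Component"
begin

definition commutator :: "('a, 'b) monoid_scheme \<Rightarrow> 'a \<Rightarrow> 'a \<Rightarrow> 'a" where
  "commutator G a b = inv\<^bsub>G\<^esub> a \<otimes>\<^bsub>G\<^esub> inv\<^bsub>G\<^esub> b \<otimes>\<^bsub>G\<^esub> a \<otimes>\<^bsub>G\<^esub> b"

primrec engel_commutator :: "('a, 'b) monoid_scheme \<Rightarrow> nat \<Rightarrow> 'a \<Rightarrow> 'a \<Rightarrow> 'a" where
  "engel_commutator G 0 x y = x"
| "engel_commutator G (Suc i) x y = commutator G (engel_commutator G i x y) y"

definition group_center :: "('a, 'b) monoid_scheme \<Rightarrow> 'a set" where
  "group_center G = {z \<in> carrier G. \<forall>g \<in> carrier G. z \<otimes>\<^bsub>G\<^esub> g = g \<otimes>\<^bsub>G\<^esub> z}"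

(* Upper central series: the (i+1)-st term is the preimage in G of the center of
   the quotient of G by the i-th term. *)
primrec upper_central :: "('a, 'b) monoid_scheme \<Rightarrow> nat \<Rightarrow> 'a set" where
  "upper_central G 0 = {\<one>\<^bsub>G\<^esub>}"
| "upper_central G (Suc i) =
     {x \<in> carrier G. upper_central G i #>\<^bsub>G\<^esub> x \<in> group_center (G Mod upper_central G i)}"

(* For finite G the series becomes stationary, and this union is its final term.
   For infinite G the hypercenter also involves transfinite terms, not covered here. *)
definition hypercenter :: "('a, 'b) monoid_scheme \<Rightarrow> 'a set" where
  "hypercenter G = (\<Union>i. upper_central G i)"

(* Loops are not removed: [x,x] = 1, so every vertex of the graphs below (the last one with
   n > 0) carries one. *)
definition engel_graph :: "('a, 'b) monoid_scheme \<Rightarrow> 'a pair_pre_digraph" where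
  "engel_graph G =
     \<lparr> pverts = carrier G - hypercenter G,
       parcs = {(x, y). x \<in> carrier G - hypercenter G \<and> y \<in> carrier G - hypercenter G \<and>
                        (\<exists>n>0. engel_commutator G n x y = \<one>\<^bsub>G\<^esub>)} \<rparr>"

definition engel_universal :: "nat \<Rightarrow> ('a, 'b) monoid_scheme \<Rightarrow> 'a set" where
  "engel_universal n G =
     {g \<in> carrier G. \<forall>x \<in> carrier G. engel_commutator G n g x = \<one>\<^bsub>G\<^esub> \<and>
                                    engel_commutator G n x g = \<one>\<^bsub>G\<^esub>}"

definition n_engel_graph :: "nat \<Rightarrow> ('a, 'b) monoid_scheme \<Rightarrow> 'a pair_pre_digraph" where
  "n_engel_graph n G =
     \<lparr> pverts = carrier G - engel_universal n G,
       parcs = {(x, y). x \<in> carrier G - engel_universal n G \<and> y \<in> carrier G - engel_universal n G \<and>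
                        engel_commutator G n x y = \<one>\<^bsub>G\<^esub>} \<rparr>"

end

theory Submission
  imports Defs "HOL-Number_Theory.Residues"
begin

text \<open>
  There is a 2-Engel edge from \<open>x\<close> to \<open>y\<close> iff \<open>y\<close> commutes with its conjugate by \<open>x\<close>. For \<open>n \<ge> 6\<close>
  the double transpositions are the hub of the graph. They are connected among themselves by
  commuting edges. A double transposition reaches every \<open>g\<close> by induction on the order of \<open>g\<close>: a
  power of \<open>g\<close> commutes with \<open>g\<close>, and if \<open>g\<close> has prime order \<open>p \<ge> 5\<close>, then the permutation
  acting on one \<open>p\<close>-cycle of \<open>g\<close> as multiplication by 4 modulo \<open>p\<close> is even, has order less than \<open>p\<close>,
  and conjugates \<open>g\<close> to a permutation commuting with \<open>g\<close>. Conversely, every \<open>g\<close> has a 2-Engel edge to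
  a double transposition or to a 3-cycle on points that \<open>g\<close> fixes, permutes cyclically, or moves
  off themselves; only the 5-cycles of \<open>A\<^sub>6\<close> need a 3-Engel edge. In \<open>A\<^sub>5\<close> and \<open>A\<^sub>6\<close> the nontrivial powers
  of a 5-cycle have 2-Engel edges only to each other, and in \<open>A\<^sub>5\<close> all Engel edges are 2-Engel.
  The vertex sets are as expected, since for every \<open>g \<noteq> id\<close> there is a 3-cycle \<open>y\<close> such that no
  iterated commutator of \<open>g\<close> with \<open>y\<close> is trivial.
\<close>

section \<open>Engel commutators in an arbitrary group\<close>

text \<open>Put z = x^-1 y x. Then [x,y] = z^-1 y, which commutes with y exactly when z does, and
  conjugation by x turns the pair (y, z) into (y', y). The conjugate y' is given by an equation
  without inverses, so that explicit permutations can be supplied for it.\<close>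

lemma engel2_iff:
  fixes G (structure)
  assumes "group G" "x \<in> carrier G" "y \<in> carrier G" "y' \<in> carrier G" "y' \<otimes> x = x \<otimes> y"
  shows "engel_commutator G 2 x y = \<one> \<longleftrightarrow> y \<otimes> y' = y' \<otimes> y"
proof -
  interpret group G by fact
  note c = assms(2-4)
  define z where "z = inv x \<otimes> y \<otimes> x"
  have z: "z \<in> carrier G" using c by (simp add: z_def)
  have "engel_commutator G 2 x y = inv (inv z \<otimes> y) \<otimes> inv y \<otimes> (inv z \<otimes> y) \<otimes> y"
    using c by (simp add: numeral_2_eq_2 commutator_def z_def inv_mult_group m_assoc)
  also have "\<dots> = inv y \<otimes> (z \<otimes> inv y \<otimes> inv z) \<otimes> y \<otimes> y"
    using c z by (simp add: inv_mult_group m_assoc)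
  also have "\<dots> = \<one> \<longleftrightarrow> y \<otimes> z = z \<otimes> y"
  proof
    assume "inv y \<otimes> (z \<otimes> inv y \<otimes> inv z) \<otimes> y \<otimes> y = \<one>"
    then have "y \<otimes> (inv y \<otimes> (z \<otimes> inv y \<otimes> inv z) \<otimes> y \<otimes> y) \<otimes> inv y \<otimes> inv y \<otimes> z \<otimes> y = y \<otimes> \<one> \<otimes> inv y \<otimes> inv y \<otimes> z \<otimes> y"
      by simp
    then have "z = inv y \<otimes> z \<otimes> y"
      using c z by (simp add: m_assoc) (simp add: m_assoc [symmetric])
    then show "y \<otimes> z = z \<otimes> y"
      using c z by (metis inv_solve_left m_assoc m_closed inv_closed)
  next
    assume a: "y \<otimes> z = z \<otimes> y"
    then have "z \<otimes> inv y = inv y \<otimes> z"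
      using c z by (metis inv_solve_left inv_solve_right m_assoc m_closed inv_closed)
    then show "inv y \<otimes> (z \<otimes> inv y \<otimes> inv z) \<otimes> y \<otimes> y = \<one>"
      using c z by (simp add: m_assoc)
  qed
  also have "\<dots> \<longleftrightarrow> y \<otimes> y' = y' \<otimes> y"
  proof -
    have xz: "x \<otimes> z = y \<otimes> x" using c by (simp add: z_def m_assoc [symmetric])
    have "x \<otimes> (y \<otimes> z) = y' \<otimes> (x \<otimes> z)" using c z assms(5) by (metis m_assoc)
    moreover have "x \<otimes> (z \<otimes> y) = y \<otimes> (x \<otimes> y)" using c z xz by (metis m_assoc)
    ultimately have 1: "x \<otimes> (y \<otimes> z) = (y' \<otimes> y) \<otimes> x" "x \<otimes> (z \<otimes> y) = (y \<otimes> y') \<otimes> x"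
      using c z xz assms(5) by (metis m_assoc)+
    show ?thesis
    proof
      assume "y \<otimes> z = z \<otimes> y"
      with 1 have "(y' \<otimes> y) \<otimes> x = (y \<otimes> y') \<otimes> x" by simp
      then show "y \<otimes> y' = y' \<otimes> y" using c by simp
    next
      assume "y \<otimes> y' = y' \<otimes> y"
      with 1 have "x \<otimes> (y \<otimes> z) = x \<otimes> (z \<otimes> y)" by simp
      then show "y \<otimes> z = z \<otimes> y" using c z by simp
    qed
  qed
  finally show ?thesis .
qed

lemma engel_commutator_closed:
  fixes G (structure)
  assumes "group G" "x \<in> carrier G" "y \<in> carrier G"
  shows "engel_commutator G k x y \<in> carrier G"
proof -
  interpret group G by fact
  show ?thesis using assms by (induction k) (auto simp: commutator_def)
qed

lemma engel_commutator_add: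
  "engel_commutator G (i + k) x y = engel_commutator G i (engel_commutator G k x y) y"
  by (induction i) auto

lemma engel_commutator_one:
  fixes G (structure)
  assumes "group G" "y \<in> carrier G"
  shows "engel_commutator G k \<one> y = \<one>"
proof -
  interpret group G by fact
  show ?thesis using assms by (induction k) (auto simp: commutator_def)
qed

lemma engel_commutator_mono:
  fixes G (structure)
  assumes "group G" "y \<in> carrier G" "engel_commutator G k x y = \<one>" "k \<le> m"
  shows "engel_commutator G m x y = \<one>"
  using engel_commutator_add[of G "m - k" k x y] engel_commutator_one[OF assms(1,2)] assms(3,4)
  by simp

lemma commutator_commute:
  fixes G (structure)
  assumes "group G" "x \<in> carrier G" "y \<in> carrier G" "x \<otimes> y = y \<otimes> x"
  shows "commutator G x y = \<one>"
proof -
  interpret group G by fact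
  have "commutator G x y = inv (y \<otimes> x) \<otimes> (x \<otimes> y)"
    using assms(2,3) by (simp add: commutator_def inv_mult_group m_assoc)
  then show ?thesis using assms(2-4) by simp
qed

text \<open>If \<open>y\<close> is an involution, it inverts \<open>[x,y]\<close>, so each further commutator with \<open>y\<close>
  squares \<open>[x,y]\<close> up to inversion.\<close>

lemma engel3_involution:
  fixes G (structure)
  assumes "group G" "x \<in> carrier G" "y \<in> carrier G" "z \<in> carrier G"
    "y \<otimes> y = \<one>" "x \<otimes> z = y \<otimes> x" "(z \<otimes> y) [^] (4::nat) = \<one>"
  shows "engel_commutator G 3 x y = \<one>"
proof -
  interpret group G by fact
  note c = assms(2-4)
  have iy: "inv y = y" using c assms(5) by (simp add: inv_equality)
  have z: "z = inv x \<otimes> y \<otimes> x" using c assms(6) by (metis inv_solve_left m_assoc m_closed inv_closed)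
  have zz: "z \<otimes> z = \<one>" using c assms(5) unfolding z
    by (metis (no_types, opaque_lifting) inv_closed l_inv m_assoc m_closed r_inv r_one)
  have iz: "inv z = z" using c zz by (simp add: inv_equality)
  define w where "w = z \<otimes> y"
  have w: "w \<in> carrier G" using c by (simp add: w_def)
  have iw: "inv w = y \<otimes> z" using c by (simp add: w_def inv_mult_group iy iz)
  have yw: "y \<otimes> w \<otimes> y = inv w" using c assms(5) by (simp add: w_def inv_mult_group iy iz m_assoc)
  \<comment> \<open>For \<open>v\<close> inverted by the involution \<open>y\<close>, the commutator
    [v,y] is v^-2. Used for w = [x,y] and then for w^-2, this shows that the threefold commutator is
    w^4.\<close>
  have step: "commutator G v y = inv v \<otimes> inv v" if "v \<in> carrier G" "y \<otimes> v \<otimes> y = inv v" for v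
    using that c by (simp add: commutator_def iy m_assoc)
  have "commutator G x y = w" using c by (simp add: commutator_def w_def z iy)
  then have "engel_commutator G 3 x y = commutator G (commutator G w y) y"
    by (simp add: numeral_3_eq_3)
  also have "commutator G w y = inv w \<otimes> inv w" using step w yw by simp
  also have "commutator G (inv w \<otimes> inv w) y = w \<otimes> w \<otimes> (w \<otimes> w)"
  proof -
    have "y \<otimes> inv w \<otimes> y = w"
      using arg_cong[OF yw, of "m_inv G"] w c by (simp add: inv_mult_group iy m_assoc)
    then have "y \<otimes> (inv w \<otimes> inv w) \<otimes> y = w \<otimes> w"
      using w c assms(5) by (metis (no_types, opaque_lifting) inv_closed m_assoc m_closed r_one)
    then show ?thesis
      using step[of "inv w \<otimes> inv w"] w by (simp add: inv_mult_group)
  qed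
  also have "\<dots> = w [^] (4::nat)" using w by (simp add: eval_nat_numeral m_assoc)
  finally show ?thesis using assms(7) by (simp add: w_def)
qed

section \<open>Engel edges between nontrivial elements of an alternating group\<close>

text \<open>For \<open>n\<close> at least 4 and \<open>k\<close> at least 1 these are the arcs of
  the k-Engel graph, because \<open>engel_universal\<close> is then the trivial subgroup.\<close>

definition engel_edges :: "nat \<Rightarrow> nat \<Rightarrow> (nat \<Rightarrow> nat) rel" where
  "engel_edges k n = {(x, y). x \<in> carrier (alt_group n) - {id} \<and> y \<in> carrier (alt_group n) - {id} \<and>
     engel_commutator (alt_group n) k x y = id}"

definition double_transp :: "'a \<Rightarrow> 'a \<Rightarrow> 'a \<Rightarrow> 'a \<Rightarrow> 'a \<Rightarrow> 'a" where
  "double_transp a b c d = transpose a b \<circ> transpose c d"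

text \<open>The right factor acts first: on distinct points, a goes to b, b to c and c to a.\<close>

definition three_cycle :: "'a \<Rightarrow> 'a \<Rightarrow> 'a \<Rightarrow> 'a \<Rightarrow> 'a" where
  "three_cycle a b c = transpose a b \<circ> transpose b c"

lemma alt_group_comp_closed:
  "x \<in> carrier (alt_group n) \<Longrightarrow> y \<in> carrier (alt_group n) \<Longrightarrow> x \<circ> y \<in> carrier (alt_group n)"
  using group.is_monoid[OF alt_group_is_group, THEN monoid.m_closed, of x n y]
  by (simp add: alt_group_mult)

lemma alt_group_bij: "x \<in> carrier (alt_group n) \<Longrightarrow> bij x"
  unfolding alt_group_carrier using permutes_bij by auto

lemma alt_group_inj_eq: "x \<in> carrier (alt_group n) \<Longrightarrow> x a = x b \<longleftrightarrow> a = b"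
  by (meson alt_group_bij bij_is_inj inj_eq)

lemma alt_group_in_range: "x \<in> carrier (alt_group n) \<Longrightarrow> x a \<in> {1..n} \<longleftrightarrow> a \<in> {1..n}"
  using permutes_in_image[of x "{1..n}" a] unfolding alt_group_carrier by auto

lemma alt_group_moved: "x \<in> carrier (alt_group n) \<Longrightarrow> x a \<noteq> a \<Longrightarrow> a \<in> {1..n}"
  using permutes_not_in[of x "{1..n}" a] unfolding alt_group_carrier by auto

lemma alt_group_conj:
  assumes "x \<in> carrier (alt_group n)" "y \<in> carrier (alt_group n)" "bij x" "y' \<circ> x = x \<circ> y"
  shows "y' \<in> carrier (alt_group n)"
proof -
  have "y' = x \<circ> y \<circ> inv' x"
    unfolding assms(4) [symmetric] using assms(3) by (simp add: comp_assoc bij_is_surj surj_iff [THEN iffD1])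
  then show ?thesis
    by (simp add: assms(1,2) alt_group_inv_closed alt_group_comp_closed)
qed

lemma engel_edges_2I:
  assumes "x \<in> carrier (alt_group n)" "y \<in> carrier (alt_group n)" "x \<noteq> id" "y \<noteq> id"
    "y' \<circ> x = x \<circ> y" "y \<circ> y' = y' \<circ> y"
  shows "(x, y) \<in> engel_edges 2 n"
  using engel2_iff[OF alt_group_is_group, of x n y y'] assms
    alt_group_conj[OF assms(1,2) alt_group_bij[OF assms(1)] assms(5)]
  by (simp add: engel_edges_def alt_group_mult alt_group_one)

lemma engel_edges_2D:
  assumes "(x, y) \<in> engel_edges 2 n" "y' \<circ> x = x \<circ> y"
  shows "y \<circ> y' = y' \<circ> y"
proof -
  have x: "x \<in> carrier (alt_group n)" "y \<in> carrier (alt_group n)"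
    using assms by (auto simp: engel_edges_def)
  show ?thesis
  using engel2_iff[OF alt_group_is_group, of x n y y'] assms x
    alt_group_conj[OF x alt_group_bij[OF x(1)] assms(2)]
  by (simp add: engel_edges_def alt_group_mult alt_group_one)
qed

lemma engel_edges_commute:
  assumes "x \<in> carrier (alt_group n)" "y \<in> carrier (alt_group n)" "x \<noteq> id" "y \<noteq> id"
    "x \<circ> y = y \<circ> x"
  shows "(x, y) \<in> engel_edges 2 n"
  by (rule engel_edges_2I[where y' = y]) (use assms in auto)

lemma engel_edges_mono: "k \<le> m \<Longrightarrow> engel_edges k n \<subseteq> engel_edges m n"
  using engel_commutator_mono[OF alt_group_is_group, of _ n k _ m]
  by (auto simp: engel_edges_def alt_group_one)

lemma double_transp_in_alt_group:
  assumes "{a, b, c, d} \<subseteq> {1..n}" "a \<noteq> b" "c \<noteq> d"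
  shows "double_transp a b c d \<in> carrier (alt_group n)"
  using assms unfolding alt_group_carrier double_transp_def
  by (auto intro!: permutes_compose permutes_swap_id
      simp: evenperm_comp permutation_swap_id evenperm_swap)

lemma three_cycle_in_alt_group:
  assumes "{a, b, c} \<subseteq> {1..n}" "a \<noteq> b" "b \<noteq> c"
  shows "three_cycle a b c \<in> carrier (alt_group n)"
  using assms unfolding alt_group_carrier three_cycle_def
  by (auto intro!: permutes_compose permutes_swap_id
      simp: evenperm_comp permutation_swap_id evenperm_swap)

lemma transpose_conj:
  assumes "inj g"
  shows "transpose (g a) (g b) \<circ> g = g \<circ> transpose a b"
  using assms by (simp add: fun_eq_iff transpose_def inj_eq)

lemma double_transp_conj:
  assumes "inj g"
  shows "double_transp (g a) (g b) (g c) (g d) \<circ> g = g \<circ> double_transp a b c d"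
  using transpose_conj[OF assms] by (simp add: double_transp_def fun_eq_iff)

lemma three_cycle_conj:
  assumes "inj g"
  shows "three_cycle (g a) (g b) (g c) \<circ> g = g \<circ> three_cycle a b c"
  using transpose_conj[OF assms] by (simp add: three_cycle_def fun_eq_iff)

lemma double_transp_neq_id: "distinct [a, b, c, d] \<Longrightarrow> double_transp a b c d \<noteq> id"
  by (auto simp: double_transp_def fun_eq_iff intro!: exI[of _ a])

lemma three_cycle_neq_id: "distinct [a, b, c] \<Longrightarrow> three_cycle a b c \<noteq> id"
  by (auto simp: three_cycle_def fun_eq_iff intro!: exI[of _ a])

section \<open>Paths between double transpositions\<close>

lemma double_transp_swap:
  "double_transp b a c d = double_transp a b c d"
  "double_transp a b d c = double_transp a b c d"
  by (simp_all add: double_transp_def transpose_commute)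

lemma double_transp_swap_pairs:
  "distinct [a, b, c, d] \<Longrightarrow> double_transp c d a b = double_transp a b c d"
  by (rule ext, rename_tac x, case_tac "x \<in> {a, b, c, d}") (auto simp: double_transp_def)

lemma double_transp_klein_commute:
  "distinct [a, b, c, d] \<Longrightarrow>
    double_transp a b c d \<circ> double_transp a c b d = double_transp a c b d \<circ> double_transp a b c d"
  by (rule ext, rename_tac x, case_tac "x \<in> {a, b, c, d}") (auto simp: double_transp_def)

lemma double_transp_share_commute:
  "distinct [a, b, c, d, e, f] \<Longrightarrow>
    double_transp a b c d \<circ> double_transp c d e f = double_transp c d e f \<circ> double_transp a b c d"
  by (rule ext, rename_tac x, case_tac "x \<in> {a, b, c, d, e, f}") (auto simp: double_transp_def)

text \<open>The double transpositions of \<open>A\<^sub>6\<close> are the flags of the generalized quadrangle of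
  duads and synthemes; the path below follows the quadrangle from one duad to another.\<close>

lemma double_transp_replace:
  assumes "distinct [a, b, c, d, e]" "{a, b, c, d, e} \<subseteq> {1..n}" "n \<ge> 6"
  shows "(double_transp a b c d, double_transp a b c e) \<in> (engel_edges 2 n)\<^sup>*"
proof -
  have "card {a, b, c, d, e} < card {1..n}"
    using assms by (simp add: card_insert_if)
  then obtain f where f: "f \<in> {1..n}" "f \<notin> {a, b, c, d, e}"
    by (meson card_mono finite.emptyI finite.insertI linorder_not_less subsetI)
  have edge: "(double_transp p q r s, double_transp r s t u) \<in> engel_edges 2 n"
    if "distinct [p, q, r, s, t, u]" "{p, q, r, s, t, u} \<subseteq> {1..n}" for p q r s t u
    using that by (intro engel_edges_commute double_transp_in_alt_group double_transp_neq_id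
        double_transp_share_commute) auto
  \<comment> \<open>The path is (a b)(c d), (c d)(e f), (c e)(d f), (a b)(c e). The outer steps
    exchange one of the two transpositions; the middle one stays in the Klein four-group on c, d, e,
    f.\<close>
  have 1: "(double_transp a b c d, double_transp c d e f) \<in> engel_edges 2 n"
    using assms f by (intro edge) auto
  have 2: "(double_transp c d e f, double_transp c e d f) \<in> engel_edges 2 n"
    using assms f by (intro engel_edges_commute double_transp_in_alt_group double_transp_neq_id
        double_transp_klein_commute) auto
  have 3: "(double_transp d f c e, double_transp c e a b) \<in> engel_edges 2 n"
    using assms f by (intro edge) auto
  have "double_transp d f c e = double_transp c e d f" "double_transp c e a b = double_transp a b c e"
    using assms f by (intro double_transp_swap_pairs; auto)+
  with 1 2 3 show ?thesis by (metis rtrancl.simps)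
qed

lemma double_transp_replace_any:
  assumes "distinct [a, b, c, d, e]" "{a, b, c, d, e} \<subseteq> {1..n}" "n \<ge> 6"
  shows "(double_transp a b c d, double_transp a b c e) \<in> (engel_edges 2 n)\<^sup>*"
    "(double_transp a b c d, double_transp a b e d) \<in> (engel_edges 2 n)\<^sup>*"
    "(double_transp a b c d, double_transp a e c d) \<in> (engel_edges 2 n)\<^sup>*"
    "(double_transp a b c d, double_transp e b c d) \<in> (engel_edges 2 n)\<^sup>*"
proof -
  show "(double_transp a b c d, double_transp a b c e) \<in> (engel_edges 2 n)\<^sup>*"
    using double_transp_replace[of a b c d e n] assms by simp
  show "(double_transp a b c d, double_transp a b e d) \<in> (engel_edges 2 n)\<^sup>*"
    using double_transp_replace[of a b d c e n] assms by (auto simp: double_transp_swap)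
  show "(double_transp a b c d, double_transp a e c d) \<in> (engel_edges 2 n)\<^sup>*"
    using double_transp_replace[of c d a b e n] assms
      double_transp_swap_pairs[of a b c d] double_transp_swap_pairs[of a e c d] by auto
  show "(double_transp a b c d, double_transp e b c d) \<in> (engel_edges 2 n)\<^sup>*"
    using double_transp_replace[of c d b a e n] assms
      double_transp_swap_pairs[of b a c d] double_transp_swap_pairs[of b e c d]
    by (auto simp: double_transp_swap)
qed

lemma double_transp_klein:
  assumes "distinct [a, b, c, d]" "{a, b, c, d} \<subseteq> {1..n}"
  shows "(double_transp a b c d, double_transp a c b d) \<in> (engel_edges 2 n)\<^sup>*"
  using assms by (intro r_into_rtrancl engel_edges_commute double_transp_in_alt_group
      double_transp_neq_id double_transp_klein_commute) auto

text \<open>If just one of the two points lies in the support, it is replaced by the other. If both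
  do, the result is the same permutation or another involution of the Klein four-group on the
  support. If neither does, nothing changes.\<close>

lemma double_transp_transpose:
  assumes "distinct [a, b, c, d]" "{a, b, c, d, u, v} \<subseteq> {1..n}" "n \<ge> 6" "t = transpose u v"
  shows "(double_transp a b c d, double_transp (t a) (t b) (t c) (t d)) \<in> (engel_edges 2 n)\<^sup>*"
proof -
  have main: "(double_transp a b c d, double_transp (transpose u v a) (transpose u v b)
      (transpose u v c) (transpose u v d)) \<in> (engel_edges 2 n)\<^sup>*"
    if u: "u \<in> {a, b, c, d}" and uv: "u \<noteq> v" and v: "v \<in> {1..n}" for u v
  proof (cases "v \<in> {a, b, c, d}")
    case False
    then show ?thesis
      using u uv v double_transp_replace_any[of a b c d v n] assms by (auto simp: transpose_def)
  next
    case True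
    have K1: "(double_transp a b c d, double_transp a c b d) \<in> (engel_edges 2 n)\<^sup>*"
      using double_transp_klein[of a b c d n] assms by auto
    \<comment> \<open>Exchanging the names of \<open>a\<close> and \<open>b\<close> gives the edge
      to the third involution of the four-group.\<close>
    have "(double_transp b a c d, double_transp b c a d) \<in> (engel_edges 2 n)\<^sup>*"
      using double_transp_klein[of b a c d n] assms by auto
    then have K2: "(double_transp a b c d, double_transp c b a d) \<in> (engel_edges 2 n)\<^sup>*"
      by (simp only: double_transp_swap(1)[of b a c d] double_transp_swap(1)[of b c a d])
    have eq1: "double_transp d b c a = double_transp a c b d"
      using double_transp_swap_pairs[of a c b d] assms(1)
      by (simp add: double_transp_swap(1)[of d b c a] double_transp_swap(2)[of b d c a] eq_commute)
    have eq2: "double_transp a d c b = double_transp c b a d"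
      using double_transp_swap_pairs[of c b a d] assms(1) by (simp add: eq_commute)
    have eq3: "double_transp b a c d = double_transp a b c d" "double_transp a b d c = double_transp a b c d"
      by (rule double_transp_swap)+
    from True u uv have "v \<in> {a, b, c, d} - {u}" by simp
    with u assms(1) show ?thesis
      by (elim insertE emptyE; simp) (use K1 K2 eq1 eq2 eq3 assms(1) in auto)
  qed
  show ?thesis
  proof (cases "u = v")
    case True
    then show ?thesis using assms by simp
  next
    case False
    consider "u \<in> {a, b, c, d}" | "v \<in> {a, b, c, d}" | "u \<notin> {a, b, c, d}" "v \<notin> {a, b, c, d}"
      by blast
    then show ?thesis
    proof cases
      case 1
      then show ?thesis using main[of u v] False assms(2,4) by simp
    next
      case 2
      then show ?thesis
        using main[of v u] False assms(2,4) by (simp add: transpose_commute[of v u])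
    next
      case 3
      then have "t a = a" "t b = b" "t c = c" "t d = d"
        unfolding assms(4) by (auto intro!: transpose_apply_other)
      then show ?thesis by simp
    qed
  qed
qed

lemma transpose_distinct_4:
  assumes "distinct [a, b, c, d]" "{a, b, c, d, u, v} \<subseteq> {1..n::nat}" "t = transpose u v"
  shows "distinct [t a, t b, t c, t d]" "{t a, t b, t c, t d} \<subseteq> {1..n}"
proof -
  have "t x = t y \<longleftrightarrow> x = y" for x y
    using inj_eq[OF inj_transpose[of u v]] assms(3) by simp
  then show "distinct [t a, t b, t c, t d]" using assms(1) by simp
  have "t x \<in> {1..n}" if "x \<in> {1..n}" for x
    using permutes_in_image[OF permutes_swap_id[of u "{1..n}" v]] that assms(2,3) by auto
  then show "{t a, t b, t c, t d} \<subseteq> {1..n}" using assms(2) by blast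
qed

text \<open>Four transpositions bring the points to their targets one at a time. Each keeps the
  targets already reached in place, since both points it exchanges differ from them.\<close>

lemma double_transps_connected:
  assumes "distinct [a, b, c, d]" "{a, b, c, d} \<subseteq> {1..n}"
    "distinct [a', b', c', d']" "{a', b', c', d'} \<subseteq> {1..n}" "n \<ge> 6"
  shows "(double_transp a b c d, double_transp a' b' c' d') \<in> (engel_edges 2 n)\<^sup>*"
proof -
  define t1 where "t1 = transpose a a'"
  define b1 c1 d1 where "b1 = t1 b" "c1 = t1 c" "d1 = t1 d"
  note defs1 = this(1-3)
  have [simp]: "t1 a = a'" by (simp add: t1_def)
  have 1: "(double_transp a b c d, double_transp a' b1 c1 d1) \<in> (engel_edges 2 n)\<^sup>*"
    using double_transp_transpose[of a b c d a a' n t1] assms by (simp add: t1_def defs1)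
  have d1: "distinct [a', b1, c1, d1]" "{a', b1, c1, d1} \<subseteq> {1..n}"
    using transpose_distinct_4[of a b c d a a' n t1] assms by (simp_all add: t1_def defs1)
  define t2 where "t2 = transpose b1 b'"
  define c2 d2 where "c2 = t2 c1" "d2 = t2 d1"
  note defs2 = this(1-2)
  have [simp]: "t2 b1 = b'" "t2 a' = a'" using d1 assms by (simp_all add: t2_def)
  have 2: "(double_transp a' b1 c1 d1, double_transp a' b' c2 d2) \<in> (engel_edges 2 n)\<^sup>*"
    using double_transp_transpose[of a' b1 c1 d1 b1 b' n t2] d1 assms by (simp add: t2_def defs2)
  have d2: "distinct [a', b', c2, d2]" "{a', b', c2, d2} \<subseteq> {1..n}"
    using transpose_distinct_4[of a' b1 c1 d1 b1 b' n t2] d1 assms by (simp_all add: t2_def defs2)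
  define t3 where "t3 = transpose c2 c'"
  define d3 where "d3 = t3 d2"
  have [simp]: "t3 c2 = c'" "t3 a' = a'" "t3 b' = b'" using d2 assms by (simp_all add: t3_def)
  have 3: "(double_transp a' b' c2 d2, double_transp a' b' c' d3) \<in> (engel_edges 2 n)\<^sup>*"
    using double_transp_transpose[of a' b' c2 d2 c2 c' n t3] d2 assms by (simp add: t3_def d3_def)
  have d3: "distinct [a', b', c', d3]" "{a', b', c', d3} \<subseteq> {1..n}"
    using transpose_distinct_4[of a' b' c2 d2 c2 c' n t3] d2 assms by (simp_all add: t3_def d3_def)
  define t4 where "t4 = transpose d3 d'"
  have [simp]: "t4 d3 = d'" "t4 a' = a'" "t4 b' = b'" "t4 c' = c'"
    using d3 assms by (simp_all add: t4_def)
  have 4: "(double_transp a' b' c' d3, double_transp a' b' c' d') \<in> (engel_edges 2 n)\<^sup>*"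
    using double_transp_transpose[of a' b' c' d3 d3 d' n t4] d3 assms by (simp add: t4_def)
  from 1 2 3 4 show ?thesis by (meson rtrancl_trans)
qed

section \<open>Multiplication on an orbit of prime length\<close>

lemma funpow_fix_mult: "(g ^^ m) a = a \<Longrightarrow> (g ^^ (k * m)) a = a"
  by (induction k) (simp_all add: funpow_add)

text \<open>As \<open>p\<close> is prime, a moved point has an orbit of exactly \<open>p\<close>
  points, so its iterates are indexed by the integers modulo \<open>p\<close>.\<close>

lemma prime_orbit_cong:
  assumes "prime p" "g ^^ p = id" "g a \<noteq> a"
  shows "(g ^^ i) a = (g ^^ j) a \<longleftrightarrow> [i = j] (mod p)"
proof
  assume "[i = j] (mod p)"
  then show "(g ^^ i) a = (g ^^ j) a"
    using funpow_mod_eq[of p g a i] funpow_mod_eq[of p g a j] assms(2) by (simp add: cong_def)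
next
  \<comment> \<open>If \<open>p\<close> does not divide \<open>k\<close>, some multiple of
    \<open>k\<close> is 1 modulo \<open>p\<close>, and a point fixed by the k-th power of
    \<open>g\<close> would be fixed by \<open>g\<close>.\<close>
  have period: "p dvd k" if k: "(g ^^ k) a = a" for k
  proof (rule ccontr)
    assume "\<not> p dvd k"
    then have "coprime k p" using assms(1) prime_imp_coprime[of p k] by (simp add: coprime_commute)
    then obtain u where "[k * u = Suc 0] (mod p)" using cong_solve_coprime_nat by blast
    then have "(k * u) mod p = Suc 0" using prime_gt_1_nat[OF assms(1)] by (simp add: cong_def)
    then have "(g ^^ (k * u)) a = g a"
      using funpow_mod_eq[of p g a "k * u"] assms(2) by simp
    moreover have "(g ^^ (k * u)) a = a" using funpow_fix_mult[OF k, of u] by (simp add: mult.commute)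
    ultimately show False using assms(3) by simp
  qed
  have inj: "inj g"
  proof (rule inj_on_inverseI)
    fix x
    show "(g ^^ (p - 1)) (g x) = x"
      using assms(2) prime_gt_0_nat[OF assms(1)] funpow_Suc_right[of "p - 1" g]
      by (simp add: fun_eq_iff)
  qed
  have *: "[i = j] (mod p)" if "(g ^^ i) a = (g ^^ j) a" "i \<le> j" for i j
  proof -
    have "(g ^^ i) ((g ^^ (j - i)) a) = (g ^^ i) a"
      using that funpow_add[of i "j - i" g] by simp
    moreover have "inj (g ^^ i)" using inj by (simp add: inj_compose inj_fn)
    ultimately have "(g ^^ (j - i)) a = a" by (simp add: inj_eq)
    then have "p dvd j - i" by (rule period)
    then show ?thesis using that(2) by (metis cong_altdef_nat cong_sym)
  qed
  assume "(g ^^ i) a = (g ^^ j) a"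
  then show "[i = j] (mod p)"
    using *[of i j] *[of j i] by (metis cong_sym nat_le_linear)
qed

text \<open>On the orbit of \<open>a\<close> under \<open>g\<close>, viewed as the integers modulo the orbit length, this is
  multiplication by \<open>k\<close>; it is the identity elsewhere.\<close>

definition orbit_mult :: "('a \<Rightarrow> 'a) \<Rightarrow> 'a \<Rightarrow> nat \<Rightarrow> 'a \<Rightarrow> 'a" where
  "orbit_mult g a k z =
     (if \<exists>i. z = (g ^^ i) a then (g ^^ (k * (LEAST i. z = (g ^^ i) a))) a else z)"

context
  fixes p :: nat and g :: "'a \<Rightarrow> 'a" and a :: 'a
  assumes p: "prime p" and gp: "g ^^ p = id" and ga: "g a \<noteq> a"
begin

text \<open>The exponent picked by \<open>LEAST\<close> is immaterial, as any two exponents of the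
  same point agree modulo \<open>p\<close>.\<close>

lemma orbit_mult_in: "orbit_mult g a k ((g ^^ i) a) = (g ^^ (k * i)) a"
proof -
  define j where "j = (LEAST j. (g ^^ i) a = (g ^^ j) a)"
  have "(g ^^ i) a = (g ^^ j) a" unfolding j_def by (rule LeastI) (rule refl)
  then have "[i = j] (mod p)" using prime_orbit_cong[OF p gp ga] by blast
  then have "[k * j = k * i] (mod p)" by (simp add: cong_scalar_left cong_sym)
  then have "(g ^^ (k * j)) a = (g ^^ (k * i)) a" using prime_orbit_cong[OF p gp ga] by blast
  then show ?thesis unfolding orbit_mult_def j_def [symmetric] by auto
qed

lemma orbit_mult_out: "\<nexists>i. z = (g ^^ i) a \<Longrightarrow> orbit_mult g a k z = z"
  by (simp add: orbit_mult_def)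

lemma orbit_mult_eqI:
  assumes "\<And>i. f ((g ^^ i) a) = h ((g ^^ i) a)" "\<And>z. \<nexists>i. z = (g ^^ i) a \<Longrightarrow> f z = h z"
  shows "f = h"
  using assms by (metis ext)

lemma orbit_mult_comp: "orbit_mult g a k \<circ> orbit_mult g a l = orbit_mult g a (k * l)"
  by (rule orbit_mult_eqI) (simp_all add: orbit_mult_in orbit_mult_out mult.assoc)

lemma orbit_mult_one: 
  assumes "[k = 1] (mod p)"
  shows "orbit_mult g a k = id"
proof (rule orbit_mult_eqI)
  fix i
  have "[k * i = i] (mod p)" using cong_scalar_right[OF assms, of i] by simp
  then show "orbit_mult g a k ((g ^^ i) a) = id ((g ^^ i) a)"
    using prime_orbit_cong[OF p gp ga] by (simp add: orbit_mult_in)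
qed (simp add: orbit_mult_out)

lemma orbit_mult_funpow: "orbit_mult g a k ^^ m = orbit_mult g a (k ^ m)"
  by (induction m) (simp_all add: orbit_mult_comp orbit_mult_one)

text \<open>Multiplication by an inverse of \<open>k\<close> modulo \<open>p\<close> is the inverse
  map. The orbit starts at a moved point, so it lies inside \<open>S\<close>.\<close>

lemma orbit_mult_permutes:
  assumes "coprime k p" "g permutes S" 
  shows "orbit_mult g a k permutes S"
proof -
  obtain l where "[k * l = 1] (mod p)" using cong_solve_coprime_nat[OF assms(1)] by auto
  then have "orbit_mult g a k \<circ> orbit_mult g a l = id" "orbit_mult g a l \<circ> orbit_mult g a k = id"
    using orbit_mult_one by (simp_all add: orbit_mult_comp mult.commute)
  then have "bij (orbit_mult g a k)" using o_bij by blast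
  moreover have "orbit_mult g a k z = z" if "z \<notin> S" for z
  proof (rule orbit_mult_out)
    have "(g ^^ i) a \<in> S" for i
      using assms(2) ga permutes_not_in[OF assms(2), of a]
      by (induction i) (auto simp: permutes_in_image)
    then show "\<nexists>i. z = (g ^^ i) a" using that by blast
  qed
  ultimately show ?thesis
    using permutes_superset[of "orbit_mult g a k" UNIV S] by (simp add: permutes_altdef)
qed

text \<open>Conjugation by \<open>orbit_mult g a k\<close> replaces the cycle of \<open>g\<close> through \<open>a\<close> by its \<open>k\<close>-th power.\<close>

lemma orbit_mult_conj:
  obtains g' where "g' \<circ> orbit_mult g a k = orbit_mult g a k \<circ> g" "g \<circ> g' = g' \<circ> g"
proof
  \<comment> \<open>Reading orbit points as integers modulo \<open>p\<close>, both sides of the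
    conjugation equation send i to k i + k. As \<open>g\<close> preserves the orbit and its
    complement, \<open>g'\<close> commutes with \<open>g\<close>.\<close>
  define g' where "g' z = (if \<exists>i. z = (g ^^ i) a then (g ^^ k) z else g z)" for z
  have orb: "(\<exists>i. g z = (g ^^ i) a) \<longleftrightarrow> (\<exists>i. z = (g ^^ i) a)" for z
  proof
    assume "\<exists>i. g z = (g ^^ i) a"
    then obtain i where i: "g z = (g ^^ i) a" by blast
    have "(g ^^ (p - 1)) (g z) = z"
      using gp prime_gt_0_nat[OF p] funpow_Suc_right[of "p - 1" g] by (simp add: fun_eq_iff)
    then have "z = (g ^^ (p - 1 + i)) a" using i by (simp add: funpow_add)
    then show "\<exists>i. z = (g ^^ i) a" by blast
  qed (metis funpow.simps(2) o_apply)
  have [simp]: "g' ((g ^^ i) a) = (g ^^ (k + i)) a" for i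
    unfolding g'_def by (auto simp: funpow_add)
  show "g' \<circ> orbit_mult g a k = orbit_mult g a k \<circ> g"
  proof (rule orbit_mult_eqI)
    fix i
    have "(orbit_mult g a k \<circ> g) ((g ^^ i) a) = orbit_mult g a k ((g ^^ Suc i) a)" by simp
    then show "(g' \<circ> orbit_mult g a k) ((g ^^ i) a) = (orbit_mult g a k \<circ> g) ((g ^^ i) a)"
      by (simp add: orbit_mult_in del: funpow.simps)
  next
    fix z assume z: "\<nexists>i. z = (g ^^ i) a"
    then show "(g' \<circ> orbit_mult g a k) z = (orbit_mult g a k \<circ> g) z"
      using orb[of z] by (simp add: orbit_mult_out g'_def)
  qed
  show "g \<circ> g' = g' \<circ> g"
    using orb by (auto simp: fun_eq_iff g'_def funpow_swap1)
qed

end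

section \<open>Paths from double transpositions to every element\<close>

lemma alt_group_funpow_closed: "x \<in> carrier (alt_group n) \<Longrightarrow> x ^^ k \<in> carrier (alt_group n)"
  by (induction k) (simp_all add: alt_group_comp_closed, simp add: alt_group_carrier)

text \<open>An even involution has at least two 2-cycles, and the product of two of them commutes
  with it.\<close>

lemma alt_group_involution_edge:
  assumes g: "g \<in> carrier (alt_group n)" "g \<noteq> id" "g ^^ 2 = id"
  obtains a b c d where "distinct [a, b, c, d]" "{a, b, c, d} \<subseteq> {1..n}"
    "(double_transp a b c d, g) \<in> engel_edges 2 n"
proof -
  have gg: "g (g x) = x" for x using g(3) by (simp add: fun_eq_iff numeral_2_eq_2)
  obtain a where a: "g a \<noteq> a" using g(2) by (auto simp: fun_eq_iff)
  have "\<exists>c. c \<notin> {a, g a} \<and> g c \<noteq> c"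
  proof (rule ccontr)
    assume "\<nexists>c. c \<notin> {a, g a} \<and> g c \<noteq> c"
    then have "g = transpose a (g a)" using gg by (auto simp: fun_eq_iff transpose_def)
    then have "\<not> evenperm g" using a evenperm_swap by metis
    then show False using g(1) by (simp add: alt_group_carrier)
  qed
  then obtain c where c: "c \<notin> {a, g a}" "g c \<noteq> c" by blast
  have d: "distinct [a, g a, c, g c]" using a c gg by (auto) metis+
  have r: "{a, g a, c, g c} \<subseteq> {1..n}"
    using alt_group_moved[OF g(1)] a c(2) gg by (metis bot_least insert_subset)
  have "double_transp (g a) a (g c) c \<circ> g = g \<circ> double_transp a (g a) c (g c)"
    using double_transp_conj[of g a "g a" c "g c"] gg alt_group_bij[OF g(1)] by (simp add: bij_is_inj)
  then have "double_transp a (g a) c (g c) \<circ> g = g \<circ> double_transp a (g a) c (g c)"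
    by (simp only: double_transp_swap(1)[of "g a" a] double_transp_swap(2)[of a "g a" "g c" c])
  then show ?thesis
    using d r g by (intro that[OF d r] engel_edges_commute double_transp_in_alt_group
        double_transp_neq_id) auto
qed

text \<open>A 3-cycle (a b c) of \<open>g\<close> commutes with \<open>g\<close>. With
  \<open>d\<close>, \<open>e\<close> off this cycle, (a b)(d e) conjugates (a b c) to its inverse,
  which gives the first edge of the path.\<close>

lemma alt_group_order_three_edge:
  assumes g: "g \<in> carrier (alt_group n)" "g \<noteq> id" "g ^^ 3 = id" and n: "n \<ge> 5"
  obtains a b c d where "distinct [a, b, c, d]" "{a, b, c, d} \<subseteq> {1..n}"
    "(double_transp a b c d, g) \<in> (engel_edges 2 n)\<^sup>*"
proof -
  have ggg: "g (g (g x)) = x" for x using g(3) by (simp add: fun_eq_iff eval_nat_numeral)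
  obtain a where a: "g a \<noteq> a" using g(2) by (auto simp: fun_eq_iff)
  define b c where "b = g a" and "c = g b"
  have [simp]: "g a = b" "g b = c" "g c = a" by (simp_all add: b_def c_def ggg)
  have "c \<noteq> a" using a ggg[of a] unfolding b_def c_def by metis
  moreover have "c \<noteq> b" using a alt_group_inj_eq[OF g(1), of "g a" a] unfolding b_def c_def by metis
  ultimately have dist: "distinct [a, b, c]" using a by auto
  have abc: "{a, b, c} \<subseteq> {1..n}"
    using alt_group_moved[OF g(1), of a] alt_group_moved[OF g(1), of b]
      alt_group_moved[OF g(1), of c] dist by auto
  have "card ({1..n} - {a, b, c}) \<ge> 2"
    using abc n dist by (simp add: card_Diff_subset card_insert_if)
  then obtain d e where de: "d \<in> {1..n} - {a, b, c}" "e \<in> {1..n} - {a, b, c}" "d \<noteq> e"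
    by (metis card_le_Suc0_iff_eq finite_Diff finite_atLeastAtMost not_less_eq_eq numeral_2_eq_2)
  have d4: "distinct [a, b, d, e]" and r4: "{a, b, d, e} \<subseteq> {1..n}"
    using dist abc de by auto
  have inj: "inj g" using alt_group_bij[OF g(1)] by (rule bij_is_inj)
  have rot: "three_cycle b c a = three_cycle a b c"
    by (rule ext, rename_tac x, case_tac "x \<in> {a, b, c}") (use dist in \<open>auto simp: three_cycle_def\<close>)
  have "(three_cycle a b c, g) \<in> engel_edges 2 n"
    using three_cycle_conj[OF inj, of a b c] dist abc g rot
    by (intro engel_edges_commute three_cycle_in_alt_group three_cycle_neq_id) auto
  moreover have "(double_transp a b d e, three_cycle a b c) \<in> engel_edges 2 n"
  proof (rule engel_edges_2I[where y' = "three_cycle b a c"])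
    have "inj (double_transp a b d e)" by (simp add: double_transp_def inj_compose inj_transpose)
    moreover have "double_transp a b d e a = b" "double_transp a b d e b = a"
      "double_transp a b d e c = c" using dist d4 de by (auto simp: double_transp_def)
    ultimately show "three_cycle b a c \<circ> double_transp a b d e = double_transp a b d e \<circ> three_cycle a b c"
      using three_cycle_conj[of "double_transp a b d e" a b c] by simp
    show "three_cycle a b c \<circ> three_cycle b a c = three_cycle b a c \<circ> three_cycle a b c"
      by (rule ext, rename_tac x, case_tac "x \<in> {a, b, c}") (use dist in \<open>auto simp: three_cycle_def\<close>)
  qed (use d4 r4 dist abc in \<open>auto intro!: double_transp_in_alt_group three_cycle_in_alt_group
        double_transp_neq_id three_cycle_neq_id\<close>)
  ultimately show ?thesis using that[OF d4 r4] by (meson converse_rtrancl_into_rtrancl rtrancl.rtrancl_refl)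
qed

lemma alt_group_prime_edge:
  assumes g: "g \<in> carrier (alt_group n)" "g \<noteq> id" "g ^^ p = id" and p: "prime p" "p \<ge> 5"
  obtains x where "x \<in> carrier (alt_group n)" "x \<noteq> id" "x ^^ (p - 1) = id"
    "(x, g) \<in> engel_edges 2 n"
proof -
  obtain a where a: "g a \<noteq> a" using g(2) by (auto simp: fun_eq_iff)
  note [simp] = orbit_mult_comp[OF p(1) g(3) a] orbit_mult_funpow[OF p(1) g(3) a]
  have gperm: "g permutes {1..n}" using g(1) by (simp add: alt_group_carrier)
  have "\<not> p dvd 2" using p(2) dvd_imp_le[of p 2] by auto
  then have cop: "coprime 2 p" using p(1) prime_imp_coprime by (metis coprime_commute)
  \<comment> \<open>Multiplication by 4 is taken as the square of multiplication by 2, which makes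
    it even whatever the parity of the latter.\<close>
  define x where "x = orbit_mult g a 2 \<circ> orbit_mult g a 2"
  have x4: "x = orbit_mult g a 4" by (simp add: x_def)
  have two: "orbit_mult g a 2 permutes {1..n}"
    using orbit_mult_permutes[OF p(1) g(3) a cop gperm] .
  then have x: "x \<in> carrier (alt_group n)"
    using permutes_compose[OF two two] permutes_imp_permutation[OF _ two]
      evenperm_comp[of "orbit_mult g a 2" "orbit_mult g a 2"]
    unfolding alt_group_carrier x_def by blast
  \<comment> \<open>Since \<open>p\<close> is at least 5, the orbit point with index 1 is moved to a
    different one, with index 4.\<close>
  have "\<not> [4 * 1 = 1] (mod p)"
    using p(2) by (simp add: cong_def)
  then have "x (g a) \<noteq> g a"
    using prime_orbit_cong[OF p(1) g(3) a, of "4 * 1" 1] orbit_mult_in[OF p(1) g(3) a, of 4 1] x4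
    by (simp del: funpow.simps add: funpow_simps_right)
  then have xid: "x \<noteq> id" by auto
  have "\<not> p dvd 4" using p(2) dvd_imp_le[of p 4] by auto
  then have "[4 ^ (p - 1) = 1] (mod p)" using fermat_theorem[OF p(1)] by simp
  then have xp: "x ^^ (p - 1) = id" using orbit_mult_one[OF p(1) g(3) a] by (simp add: x4)
  obtain g' where "g' \<circ> x = x \<circ> g" "g \<circ> g' = g' \<circ> g"
    using orbit_mult_conj[OF p(1) g(3) a, of 4] unfolding x4 .
  then have "(x, g) \<in> engel_edges 2 n" using engel_edges_2I[OF x g(1) xid g(2)] by blast
  then show ?thesis using that x xid xp by blast
qed

text \<open>The induction runs over any exponent \<open>m\<close> killing \<open>g\<close>, not only
  the order. A prime \<open>m\<close> of at least 5 leads to an element killed by m - 1. If m = q r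
  with \<open>q\<close> prime and \<open>m\<close> composite, then either \<open>q\<close> already
  kills \<open>g\<close>, or the q-th power of \<open>g\<close> is nontrivial, commutes with
  \<open>g\<close> and is killed by \<open>r\<close>.\<close>

lemma double_transp_reaches:
  assumes "g \<in> carrier (alt_group n)" "g \<noteq> id" "g ^^ m = id" "m > 0" "n \<ge> 5"
  obtains a b c d where "distinct [a, b, c, d]" "{a, b, c, d} \<subseteq> {1..n}"
    "(double_transp a b c d, g) \<in> (engel_edges 2 n)\<^sup>*"
proof -
  have "\<exists>a b c d. distinct [a, b, c, d] \<and> {a, b, c, d} \<subseteq> {1..n} \<and>
    (double_transp a b c d, g) \<in> (engel_edges 2 n)\<^sup>*" (is "?R g")
    using assms(1-4)
  proof (induction m arbitrary: g rule: less_induct)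
    case (less m)
    have m1: "m \<noteq> 1" using less.prems by auto
    show "?R g"
    proof (cases "prime m")
      case True
      consider "m = 2" | "m = 3" | "m \<ge> 5"
        using prime_ge_2_nat[OF True] prime_odd_nat[OF True] by (cases "m = 2"; cases "m = 3"; cases "m = 4") auto
      then show ?thesis
      proof cases
        case 1
        with less.prems show ?thesis using alt_group_involution_edge[of g n] by (metis r_into_rtrancl)
      next
        case 2
        with less.prems assms(5) show ?thesis using alt_group_order_three_edge[of g n] by metis
      next
        case 3
        obtain x where x: "x \<in> carrier (alt_group n)" "x \<noteq> id" "x ^^ (m - 1) = id"
          "(x, g) \<in> engel_edges 2 n"
          using alt_group_prime_edge[OF less.prems(1-3) True 3] .
        have "m - 1 < m" "m - 1 > 0" using 3 by simp_all
        then have "?R x" using less.IH x(1-3) by blast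
        then show ?thesis using x(4) by (meson rtrancl.rtrancl_into_rtrancl)
      qed
    next
      case False
      obtain q where q: "prime q" "q dvd m" using prime_factor_nat[OF m1] by blast
      then obtain r where r: "m = q * r" by blast
      have "q < m" using q False less.prems(4) by (metis dvd_imp_le le_neq_implies_less)
      have "r < m" "r > 0" using r less.prems(4) prime_gt_1_nat[OF q(1)] by auto
      show ?thesis
      proof (cases "g ^^ q = id")
        case True
        then show ?thesis using less.IH[OF \<open>q < m\<close>] less.prems prime_gt_0_nat[OF q(1)] by blast
      next
        case False
        have h: "g ^^ q \<in> carrier (alt_group n)" using less.prems by (simp add: alt_group_funpow_closed)
        have "(g ^^ q) ^^ r = id" using less.prems(3) unfolding r funpow_mult .
        then have "?R (g ^^ q)" using less.IH[OF \<open>r < m\<close> h False] \<open>r > 0\<close> by blast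
        moreover have "(g ^^ q, g) \<in> engel_edges 2 n"
          using engel_edges_commute[OF h less.prems(1) False less.prems(2)]
          by (simp add: fun_eq_iff funpow_swap1)
        ultimately show ?thesis by (meson rtrancl.rtrancl_into_rtrancl)
      qed
    qed
  qed
  then show ?thesis using that by blast
qed

lemma double_transp_reaches_all:
  assumes "g \<in> carrier (alt_group n)" "g \<noteq> id" "n \<ge> 6" "distinct [a, b, c, d]" "{a, b, c, d} \<subseteq> {1..n}"
  shows "(double_transp a b c d, g) \<in> (engel_edges 2 n)\<^sup>*"
proof -
  obtain m where m: "g ^^ m = id" "m > 0"
    using permutation_is_nilpotent[OF alt_group_carrier'[OF assms(1)]] .
  have "n \<ge> 5" using assms(3) by simp
  then obtain a' b' c' d' where d: "distinct [a', b', c', d']" "{a', b', c', d'} \<subseteq> {1..n}"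
    "(double_transp a' b' c' d', g) \<in> (engel_edges 2 n)\<^sup>*"
    using double_transp_reaches[OF assms(1,2) m] by blast
  then show ?thesis
    using double_transps_connected[OF assms(4,5) d(1,2) assms(3)] by (meson rtrancl_trans)
qed

section \<open>Paths from every element to double transpositions, in degree at least 7\<close>

lemma three_cycle_rotate: "distinct [a, b, c] \<Longrightarrow> three_cycle b c a = three_cycle a b c"
  by (rule ext, rename_tac x, case_tac "x \<in> {a, b, c}") (auto simp: three_cycle_def)

lemma three_cycle_disjoint_commute:
  assumes "{a, b, c} \<inter> {a', b', c'} = {}"
  shows "three_cycle a b c \<circ> three_cycle a' b' c' = three_cycle a' b' c' \<circ> three_cycle a b c"
proof -
  have "inj (three_cycle a b c)" by (simp add: three_cycle_def inj_compose inj_transpose)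
  moreover have "three_cycle a b c a' = a'" "three_cycle a b c b' = b'" "three_cycle a b c c' = c'"
    using assms by (auto simp: three_cycle_def)
  ultimately show ?thesis using three_cycle_conj[of "three_cycle a b c" a' b' c'] by simp
qed

text \<open>In the three cases the conjugate of the 3-cycle by \<open>g\<close> is disjoint from it,
  or equal to it, or equal to it after rotation; so the two commute.\<close>

lemma engel_edge_to_three_cycle:
  assumes "g \<in> carrier (alt_group n)" "g \<noteq> id" "distinct [a, b, c]" "{a, b, c} \<subseteq> {1..n}"
    "{g a, g b, g c} \<inter> {a, b, c} = {} \<or> g a = a \<and> g b = b \<and> g c = c \<or> g a = b \<and> g b = c \<and> g c = a"
  shows "(g, three_cycle a b c) \<in> engel_edges 2 n"
proof (rule engel_edges_2I[where y' = "three_cycle (g a) (g b) (g c)"])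
  show "three_cycle (g a) (g b) (g c) \<circ> g = g \<circ> three_cycle a b c"
    by (rule three_cycle_conj) (use alt_group_bij[OF assms(1)] bij_is_inj in blast)
  show "three_cycle a b c \<circ> three_cycle (g a) (g b) (g c) = three_cycle (g a) (g b) (g c) \<circ> three_cycle a b c"
    using assms(5) three_cycle_disjoint_commute[of a b c "g a" "g b" "g c"]
      three_cycle_rotate[OF assms(3)] by (elim disjE) (auto simp: Int_commute)
qed (use assms in \<open>auto intro!: three_cycle_in_alt_group three_cycle_neq_id\<close>)

lemma engel_edge_to_double_transp:
  assumes "g \<in> carrier (alt_group n)" "g \<noteq> id" "distinct [a, b, c, d]" "{a, b, c, d} \<subseteq> {1..n}"
    "double_transp a b c d \<circ> double_transp (g a) (g b) (g c) (g d) =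
     double_transp (g a) (g b) (g c) (g d) \<circ> double_transp a b c d"
  shows "(g, double_transp a b c d) \<in> engel_edges 2 n"
proof (rule engel_edges_2I[where y' = "double_transp (g a) (g b) (g c) (g d)"])
  show "double_transp (g a) (g b) (g c) (g d) \<circ> g = g \<circ> double_transp a b c d"
    by (rule double_transp_conj) (use alt_group_bij[OF assms(1)] bij_is_inj in blast)
qed (use assms in \<open>auto intro!: double_transp_in_alt_group double_transp_neq_id\<close>)

definition reaches_double_transp :: "nat \<Rightarrow> nat \<Rightarrow> (nat \<Rightarrow> nat) \<Rightarrow> bool" where
  "reaches_double_transp k n g \<longleftrightarrow> (\<exists>a b c d. distinct [a, b, c, d] \<and> {a, b, c, d} \<subseteq> {1..n} \<and>
     (g, double_transp a b c d) \<in> (engel_edges k n)\<^sup>*)"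

lemma reaches_double_transp_direct:
  assumes "g \<in> carrier (alt_group n)" "g \<noteq> id" "distinct [a, b, c, d]" "{a, b, c, d} \<subseteq> {1..n}"
    "double_transp a b c d \<circ> double_transp (g a) (g b) (g c) (g d) =
     double_transp (g a) (g b) (g c) (g d) \<circ> double_transp a b c d"
  shows "reaches_double_transp 2 n g"
  unfolding reaches_double_transp_def
  by (intro exI conjI, rule assms(3), rule assms(4), rule r_into_rtrancl,
      rule engel_edge_to_double_transp[OF assms])

lemma reaches_double_transp_step:
  "(g, h) \<in> engel_edges k n \<Longrightarrow> reaches_double_transp k n h \<Longrightarrow> reaches_double_transp k n g"
  unfolding reaches_double_transp_def by (meson converse_rtrancl_into_rtrancl)

lemma reaches_double_transp_mono:
  "k \<le> m \<Longrightarrow> reaches_double_transp k n g \<Longrightarrow> reaches_double_transp m n g"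
  unfolding reaches_double_transp_def by (meson rtrancl_mono[OF engel_edges_mono] subsetD)

text \<open>Degree 7 leaves four points off the cycle, and a double transposition of these commutes
  with it.\<close>

lemma three_cycle_reaches_double_transp:
  assumes "distinct [a, b, c]" "{a, b, c} \<subseteq> {1..n}" "n \<ge> 7"
  shows "reaches_double_transp 2 n (three_cycle a b c)"
proof -
  have "card ({1..n} - {a, b, c}) \<ge> 4"
    using assms by (simp add: card_Diff_subset card_insert_if)
  then obtain X where X: "X \<subseteq> {1..n} - {a, b, c}" "card X = 4"
    by (meson obtain_subset_with_card_n)
  then have "finite X" by (simp add: card_ge_0_finite)
  then obtain xs where xs: "set xs = X" "distinct xs" using finite_distinct_list by blast
  then have "length xs = 4" using X(2) distinct_card by metis
  then obtain p q r s where "xs = [p, q, r, s]"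
    by (auto simp: numeral_eq_Suc length_Suc_conv)
  with xs have "X = {p, q, r, s}" "distinct [p, q, r, s]" by auto
  then have pq: "distinct [p, q, r, s]" "{p, q, r, s} \<subseteq> {1..n}" "{a, b, c} \<inter> {p, q, r, s} = {}"
    using X by auto
  have [simp]: "three_cycle a b c p = p" "three_cycle a b c q = q"
    "three_cycle a b c r = r" "three_cycle a b c s = s"
    using pq by (auto simp: three_cycle_def)
  show ?thesis
    using assms pq
    by (intro reaches_double_transp_direct[OF _ _ pq(1,2)] three_cycle_in_alt_group three_cycle_neq_id)
      simp_all
qed

text \<open>The hypotheses put \<open>x\<close> on a 4-cycle of \<open>g\<close>. The square of that
  cycle is a double transposition centralized by \<open>g\<close>.\<close>

lemma four_cycle_reaches_double_transp:
  assumes g: "g \<in> carrier (alt_group n)" and x: "g (g (g (g x))) = x" "g (g x) \<noteq> x"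
  shows "reaches_double_transp 2 n g"
proof -
  note inj = alt_group_inj_eq[OF g]
  define y z w where "y = g x" and "z = g y" and "w = g z"
  have s [simp]: "g x = y" "g y = z" "g z = w" "g w = x"
    using x by (simp_all add: y_def z_def w_def)
  have ne: "x \<noteq> z" using x(2) by simp
  then have "x \<noteq> y" using s(1,2) by metis
  with ne have d: "distinct [x, z, y, w]"
    using inj[of x y] inj[of x z] inj[of y z] inj[of x w] inj[of z w] by auto
  have "x \<in> {1..n}" using alt_group_moved[OF g, of x] \<open>x \<noteq> y\<close> by simp
  then have r: "{x, z, y, w} \<subseteq> {1..n}"
    using alt_group_in_range[OF g, of x] alt_group_in_range[OF g, of y] alt_group_in_range[OF g, of z]
    by simp
  have "double_transp y w z x = double_transp x z y w"
    using double_transp_swap(2)[of y w z x] double_transp_swap_pairs[OF d] by simp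
  moreover have "g \<noteq> id" using s(1) \<open>x \<noteq> y\<close> by (metis id_apply)
  ultimately show ?thesis
    by (intro reaches_double_transp_direct[OF g _ d r]) simp_all
qed

lemma two_transpositions_reach_double_transp:
  assumes g: "g \<in> carrier (alt_group n)"
    and x: "g (g x) = x" "g x \<noteq> x" and y: "g (g y) = y" "g y \<noteq> y" "y \<notin> {x, g x}"
  shows "reaches_double_transp 2 n g"
proof -
  have d: "distinct [x, g x, y, g y]"
    using x y alt_group_inj_eq[OF g, of x y] alt_group_inj_eq[OF g, of "g x" y] by auto
  have "x \<in> {1..n}" "y \<in> {1..n}" using alt_group_moved[OF g] x y by blast+
  then have r: "{x, g x, y, g y} \<subseteq> {1..n}"
    using alt_group_in_range[OF g, of x] alt_group_in_range[OF g, of y] by simp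
  have "double_transp (g x) x (g y) y = double_transp x (g x) y (g y)"
    using double_transp_swap(1)[of "g x" x] double_transp_swap(2)[of x "g x"] by simp
  then show ?thesis
    using d x y by (intro reaches_double_transp_direct[OF g _ d r]) auto
qed

text \<open>The hypotheses exclude all cycle lengths up to 4 for \<open>x\<close>.\<close>

lemma obtain_five_distinct_iterates:
  assumes g: "g \<in> carrier (alt_group n)" and x: "g (g x) \<noteq> x" "g (g (g x)) \<noteq> x" "g (g (g (g x))) \<noteq> x"
  obtains y z w v where "g x = y" "g y = z" "g z = w" "g w = v" "distinct [x, y, z, w, v]"
    "{x, y, z, w, v} \<subseteq> {1..n}"
proof -
  note inj = alt_group_inj_eq[OF g]
  define y z w v where "y = g x" and "z = g y" and "w = g z" and "v = g w"
  have s [simp]: "g x = y" "g y = z" "g z = w" "g w = v" by (simp_all add: y_def z_def w_def v_def)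
  have ne: "x \<noteq> z" "x \<noteq> w" "x \<noteq> v" using x by auto
  then have "x \<noteq> y" using s(1,2) by metis
  with ne have d: "distinct [x, y, z, w, v]"
    using inj[of x y] inj[of x z] inj[of x w] inj[of y z] inj[of y w] inj[of z w] by auto
  have "x \<in> {1..n}" using alt_group_moved[OF g, of x] \<open>x \<noteq> y\<close> by simp
  then have r: "{x, y, z, w, v} \<subseteq> {1..n}"
    using alt_group_in_range[OF g, of x] alt_group_in_range[OF g, of y]
      alt_group_in_range[OF g, of z] alt_group_in_range[OF g, of w] by simp
  show ?thesis using that[OF s d r] .
qed

text \<open>A counterexample is narrowed down by cycle type: it has no 3-cycle, no 4-cycle, at most
  two fixed points and at most one 2-cycle. This forces a 5-cycle with all other points fixed, which
  then also has an edge to a double transposition.\<close>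

lemma alt_group_reaches_double_transp:
  assumes g: "g \<in> carrier (alt_group n)" "g \<noteq> id" and n: "n \<ge> 7"
  shows "reaches_double_transp 2 n g"
proof -
  have three: "reaches_double_transp 2 n g"
    if "distinct [a, b, c]" "{a, b, c} \<subseteq> {1..n}"
      "{g a, g b, g c} \<inter> {a, b, c} = {} \<or> g a = a \<and> g b = b \<and> g c = c \<or> g a = b \<and> g b = c \<and> g c = a"
    for a b c
    using reaches_double_transp_step[OF engel_edge_to_three_cycle[OF g that]
        three_cycle_reaches_double_transp[OF that(1,2) n]] .
  have range: "{a, g a, g (g a)} \<subseteq> {1..n}" if "g a \<noteq> a" for a
    using alt_group_moved[OF g(1) that] alt_group_in_range[OF g(1), of a]
      alt_group_in_range[OF g(1), of "g a"] by simp
  note inj = alt_group_inj_eq[OF g(1)]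
  show ?thesis
  proof (rule ccontr)
    assume contr: "\<not> reaches_double_transp 2 n g"
    have no3: "g (g (g x)) \<noteq> x" if "g x \<noteq> x" for x
    proof
      assume c: "g (g (g x)) = x"
      have "g (g x) \<noteq> x" using c that by metis
      moreover have "g (g x) \<noteq> g x" using that inj by simp
      ultimately have "distinct [x, g x, g (g x)]" using that by auto
      then show False using three[OF _ range[OF that]] contr c by blast
    qed
    have no4: "g (g (g (g x))) \<noteq> x" if "g (g x) \<noteq> x" for x
      using four_cycle_reaches_double_transp[OF g(1) _ that] contr by blast
    have fix2: "card {x \<in> {1..n}. g x = x} \<le> 2"
    proof (rule ccontr)
      assume "\<not> card {x \<in> {1..n}. g x = x} \<le> 2"
      then have "3 \<le> card {x \<in> {1..n}. g x = x}" by simp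
      then obtain X where X: "X \<subseteq> {x \<in> {1..n}. g x = x}" "card X = 3"
        by (rule obtain_subset_with_card_n)
      then obtain a b c where "X = {a, b, c}" "distinct [a, b, c]" by (auto simp: card_3_iff)
      then show False using three[of a b c] X contr by auto
    qed
    have "\<exists>A. card A \<le> 2 \<and> finite A \<and> {x \<in> {1..n}. g x \<noteq> x \<and> g (g x) = x} \<subseteq> A"
    proof (cases "\<exists>x. g x \<noteq> x \<and> g (g x) = x")
      case True
      then obtain x where x: "g x \<noteq> x" "g (g x) = x" by blast
      have "y \<in> {x, g x}" if "g y \<noteq> y" "g (g y) = y" for y
        using two_transpositions_reach_double_transp[OF g(1) x(2,1) that(2,1)] contr by blast
      then have "{x \<in> {1..n}. g x \<noteq> x \<and> g (g x) = x} \<subseteq> {x, g x}" by blast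
      then show ?thesis by (intro exI[of _ "{x, g x}"]) (simp add: card_insert_if)
    next
      case False
      then show ?thesis by (intro exI[of _ "{}"]) auto
    qed
    then obtain A where A: "card A \<le> 2" "finite A" "{x \<in> {1..n}. g x \<noteq> x \<and> g (g x) = x} \<subseteq> A" by blast
    \<comment> \<open>At most four points lie on cycles of length 1 or 2, so one of the seven or
      more points lies on a longer cycle.\<close>
    have "card ({x \<in> {1..n}. g x = x} \<union> A) \<le> 4"
      using card_Un_le[of "{x \<in> {1..n}. g x = x}" A] fix2 A(1) by linarith
    then have "\<not> {1..n} \<subseteq> {x \<in> {1..n}. g x = x} \<union> A"
      using n card_mono[of "{x \<in> {1..n}. g x = x} \<union> A" "{1..n}"] A(2) by auto
    then obtain x where x: "x \<in> {1..n}" "x \<notin> {x \<in> {1..n}. g x = x} \<union> A" by blast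
    then have "g (g x) \<noteq> x" using A(3) by blast
    then have "g (g x) \<noteq> x" "g (g (g x)) \<noteq> x" "g (g (g (g x))) \<noteq> x" 
      using no3[of x] no4[of x] by auto
    from obtain_five_distinct_iterates[OF g(1) this]
    obtain y z w v where it [simp]: "g x = y" "g y = z" "g z = w" "g w = v"
      and d: "distinct [x, y, z, w, v]" and r: "{x, y, z, w, v} \<subseteq> {1..n}" .
    \<comment> \<open>On a cycle longer than 5, every second point x, z, v gives a triple that
      \<open>g\<close> moves off itself.\<close>
    have gv: "g v = x"
    proof (rule ccontr)
      assume "g v \<noteq> x"
      moreover have "g v \<noteq> z" "g v \<noteq> v" using inj[of v y] inj[of v w] d by auto
      ultimately have "{g x, g z, g v} \<inter> {x, z, v} = {}" using d by auto
      then show False using three[of x z v] d r contr by auto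
    qed
    have "card ({1..n} - {x, y, z, w, v}) \<ge> 2"
      using n r d by (simp add: card_Diff_subset card_insert_if)
    then obtain s t where st: "s \<in> {1..n} - {x, y, z, w, v}" "t \<in> {1..n} - {x, y, z, w, v}" "s \<noteq> t"
      by (metis card_le_Suc0_iff_eq finite_Diff finite_atLeastAtMost not_less_eq_eq numeral_2_eq_2)
    \<comment> \<open>A moved point \<open>u\<close> off the 5-cycle would, together with x and z,
      form a triple that \<open>g\<close> moves off itself.\<close>
    have fixed: "g u = u" if "u \<in> {1..n} - {x, y, z, w, v}" for u
    proof (rule ccontr)
      assume "g u \<noteq> u"
      moreover have "g u \<noteq> x" "g u \<noteq> z" using inj[of u v] inj[of u y] that gv by auto
      ultimately have "{g x, g z, g u} \<inter> {x, z, u} = {}" using d that by auto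
      then show False using three[of x z u] d r contr that by auto
    qed
    \<comment> \<open>With \<open>s\<close> and \<open>t\<close> fixed, \<open>g\<close> conjugates
      (x z)(s t) to (y w)(s t), which commutes with it.\<close>
    have "distinct [x, z, s, t, y, w]" using d st by auto
    from double_transp_share_commute[OF this]
    have "double_transp x z s t \<circ> double_transp y w s t = double_transp y w s t \<circ> double_transp x z s t"
      using double_transp_swap_pairs[of s t y w] d st by auto
    then have "reaches_double_transp 2 n g"
      using reaches_double_transp_direct[OF g, of x z s t] d r st fixed[OF st(1)] fixed[OF st(2)] by auto
    with contr show False by simp
  qed
qed

section \<open>Paths to double transpositions in degree 6\<close>

lemma engel_edges_3I:
  assumes "g \<in> carrier (alt_group n)" "y \<in> carrier (alt_group n)" "g \<noteq> id" "y \<noteq> id"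
    "z \<in> carrier (alt_group n)" "y \<circ> y = id" "g \<circ> z = y \<circ> g" "(z \<circ> y) ^^ 4 = id"
  shows "(g, y) \<in> engel_edges 3 n"
proof -
  interpret group "alt_group n" by (rule alt_group_is_group)
  have "(z \<otimes>\<^bsub>alt_group n\<^esub> y) [^]\<^bsub>alt_group n\<^esub> (k::nat) = (z \<circ> y) ^^ k" for k
  proof (induction k)
    case (Suc k)
    then show ?case by (simp add: alt_group_mult funpow_Suc_right del: funpow.simps(2))
  qed (simp add: alt_group_one)
  then show ?thesis
    using engel3_involution[OF alt_group_is_group assms(1,2,5)] assms
    by (simp add: engel_edges_def alt_group_mult alt_group_one)
qed

text \<open>If \<open>g\<close> fixes one of the other three points, say d, it conjugates (a b)(c d)
  to (b c)(a d), in the same Klein four-group. Otherwise it permutes them in a 3-cycle through d, e,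
  f and conjugates (a d)(b e) to (b e)(c f), which commutes with the former.\<close>

lemma alt_group_6_three_cycle_reaches:
  assumes g: "g \<in> carrier (alt_group 6)" and abc: "distinct [a, b, c]" "g a = b" "g b = c" "g c = a"
  shows "reaches_double_transp 2 6 g"
proof -
  note inj = alt_group_inj_eq[OF g(1)]
  have gid: "g \<noteq> id" using abc by auto
  have "a \<in> {1..6}" using alt_group_moved[OF g, of a] abc by auto
  then have r: "{a, b, c} \<subseteq> {1..6}"
    using alt_group_in_range[OF g, of a] alt_group_in_range[OF g, of b] abc by simp
  have out: "g x \<notin> {a, b, c}" if "x \<notin> {a, b, c}" for x
    using that abc inj[of x a] inj[of x b] inj[of x c] by auto
  have "card ({1..6} - {a, b, c}) = 3"
    using abc(1) r by (simp add: card_Diff_subset card_insert_if)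
  then obtain d0 e0 f0 where D: "{1..6} - {a, b, c} = {d0, e0, f0}" "distinct [d0, e0, f0]"
    by (auto simp: card_3_iff)
  show ?thesis
  proof (cases "\<exists>d \<in> {1..6} - {a, b, c}. g d = d")
    case True
    then obtain d where d: "d \<in> {1..6} - {a, b, c}" "g d = d" by blast
    have dist: "distinct [b, a, c, d]" "distinct [a, b, c, d]" "{a, b, c, d} \<subseteq> {1..6}"
      using abc d r by auto
    have "double_transp a b c d \<circ> double_transp b c a d = double_transp b c a d \<circ> double_transp a b c d"
      using double_transp_klein_commute[OF dist(1)] unfolding double_transp_swap(1)[of b a] .
    then show ?thesis
      using d abc by (intro reaches_double_transp_direct[OF g gid dist(2,3)]) simp
  next
    case False
    obtain d where d: "d \<in> {1..6} - {a, b, c}" using D by blast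
    define e f where "e = g d" and "f = g e"
    have maps: "g x \<in> {1..6} - {a, b, c}" if "x \<in> {1..6} - {a, b, c}" for x
      using that out[of x] alt_group_in_range[OF g, of x] by auto
    have e: "e \<in> {1..6} - {a, b, c}" "e \<noteq> d" using maps[OF d] False d by (auto simp: e_def)
    have f: "f \<in> {1..6} - {a, b, c}" "f \<noteq> e" using maps[OF e(1)] False e(1) by (auto simp: f_def)
    have "f \<noteq> d"
    proof
      assume "f = d"
      have "card ({1..6} - {a, b, c} - {d, e}) = 1"
        using \<open>card ({1..6} - {a, b, c}) = 3\<close> d e by (simp add: card_Diff_subset)
      then obtain h where h: "{1..6} - {a, b, c} - {d, e} = {h}" by (rule card_1_singletonE)
      then have "h \<in> {1..6} - {a, b, c} - {d, e}" by blast
      then have h': "h \<in> {1..6} - {a, b, c}" "h \<noteq> d" "h \<noteq> e" by blast+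
      have "g h \<noteq> d" using inj[of h e] h'(3) \<open>f = d\<close> unfolding f_def by metis
      moreover have "g h \<noteq> e" using inj[of h d] h'(2) unfolding e_def by metis
      ultimately have "g h = h" using maps[OF h'(1)] h by blast
      then show False using False h'(1) by blast
    qed
    then have dist: "distinct [a, d, b, e]" "{a, d, b, e} \<subseteq> {1..6}" "distinct [a, d, b, e, c, f]"
      using abc d e f r by auto
    have "double_transp a d b e \<circ> double_transp b e c f = double_transp b e c f \<circ> double_transp a d b e"
      by (rule double_transp_share_commute[OF dist(3)])
    then show ?thesis
      using abc by (intro reaches_double_transp_direct[OF g gid dist(1,2)]) (simp add: e_def f_def)
  qed
qed

text \<open>A 5-cycle of \<open>A\<^sub>6\<close> needs a 3-Engel edge to reach a double transposition.\<close>

lemma alt_group_6_five_cycle_reaches: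
  assumes g: "g \<in> carrier (alt_group 6)" and d: "distinct [x, y, z, w, v, u]"
    and r: "{x, y, z, w, v, u} \<subseteq> {1..6}"
    and it: "g x = y" "g y = z" "g z = w" "g w = v" "g v = x" "g u = u"
  shows "reaches_double_transp 3 6 g"
proof -
  \<comment> \<open>\<open>E\<close> is the conjugate of \<open>D\<close> by the inverse of
    \<open>g\<close>, so the commutator of \<open>g\<close> with \<open>D\<close> is E D. This is
    the product of the 4-cycle (x w u y) and the transposition (z v), so its fourth power is
    trivial.\<close>
  define D E where "D = double_transp x w y u" and "E = double_transp v z x u"
  have "(g, D) \<in> engel_edges 3 6"
  proof (rule engel_edges_3I[where z = E])
    show "D \<in> carrier (alt_group 6)" "E \<in> carrier (alt_group 6)"
      unfolding D_def E_def using d r by (auto intro!: double_transp_in_alt_group)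
    show "g \<noteq> id" using d it(1) by auto
    show "D \<noteq> id" unfolding D_def using d by (intro double_transp_neq_id) auto
    show "D \<circ> D = id"
      by (rule ext, rename_tac t, case_tac "t \<in> {x, w, y, u}")
        (use d in \<open>auto simp: D_def double_transp_def\<close>)
    show "g \<circ> E = D \<circ> g"
      using double_transp_conj[of g v z x u] it alt_group_bij[OF g]
      by (simp add: D_def E_def bij_is_inj)
    have [simp]: "D x = w" "D w = x" "D y = u" "D u = y" "D z = z" "D v = v"
      "E v = z" "E z = v" "E x = u" "E u = x" "E y = y" "E w = w"
      using d by (auto simp: D_def E_def double_transp_def)
    have [simp]: "D t = t" "E t = t" if "t \<notin> {x, y, z, w, v, u}" for t
      using that by (auto simp: D_def E_def double_transp_def)
    show "(E \<circ> D) ^^ 4 = id"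
    proof
      fix t
      show "((E \<circ> D) ^^ 4) t = id t"
        by (cases "t \<in> {x, y, z, w, v, u}") (auto simp: eval_nat_numeral)
    qed
  qed (rule g)
  then show ?thesis
    unfolding reaches_double_transp_def D_def using d r
    by (intro exI[of _ x] exI[of _ w] exI[of _ y] exI[of _ u]) auto
qed

lemma alt_group_6_reaches_double_transp:
  assumes g: "g \<in> carrier (alt_group 6)" "g \<noteq> id"
  shows "reaches_double_transp 3 6 g"
proof (rule ccontr)
  assume contr: "\<not> reaches_double_transp 3 6 g"
  then have contr2: "\<not> reaches_double_transp 2 6 g"
    using reaches_double_transp_mono[of 2 3] by auto
  note inj = alt_group_inj_eq[OF g(1)]
  have "\<exists>x. g (g x) \<noteq> x"
  proof (rule ccontr)
    assume "\<nexists>x. g (g x) \<noteq> x"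
    then have gg: "g (g x) = x" for x by blast
    then have "g ^^ 2 = id" by (simp add: fun_eq_iff numeral_2_eq_2)
    obtain x where x: "g x \<noteq> x" using g(2) by (auto simp: fun_eq_iff)
    have "g y = y" if "y \<notin> {x, g x}" for y
      using two_transpositions_reach_double_transp[OF g(1) gg x gg _ that] contr2 by blast
    then have "g = transpose x (g x)" using gg by (auto simp: fun_eq_iff transpose_def)
    then have "\<not> evenperm g" using x evenperm_swap by metis
    then show False using g(1) by (simp add: alt_group_carrier)
  qed
  then obtain x where x2: "g (g x) \<noteq> x" by blast
  have x3: "g (g (g x)) \<noteq> x"
  proof
    assume c: "g (g (g x)) = x"
    have "g x \<noteq> x" using x2 by metis
    moreover have "g (g x) \<noteq> g x" using \<open>g x \<noteq> x\<close> inj by simp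
    ultimately have "distinct [x, g x, g (g x)]" using x2 by auto
    then show False using alt_group_6_three_cycle_reaches[OF g(1) _ refl refl c] contr2 by blast
  qed
  have x4: "g (g (g (g x))) \<noteq> x"
    using four_cycle_reaches_double_transp[OF g(1) _ x2] contr2 by blast
  from obtain_five_distinct_iterates[OF g(1) x2 x3 x4]
  obtain y z w v where it: "g x = y" "g y = z" "g z = w" "g w = v"
    and d: "distinct [x, y, z, w, v]" and r: "{x, y, z, w, v} \<subseteq> {1..6}" .
  \<comment> \<open>Otherwise \<open>g\<close> moves the triple x, z, v off itself and has an edge
    to the 3-cycle on it. That 3-cycle reaches a double transposition by the previous case.\<close>
  have gv: "g v = x"
  proof (rule ccontr)
    assume "g v \<noteq> x"
    moreover have "g v \<noteq> z" using inj[of v y] d it(2) by auto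
    moreover have "g v \<noteq> v" using inj[of v w] d it(4) by auto
    ultimately have disj: "{g x, g z, g v} \<inter> {x, z, v} = {}" using d it by auto
    have dT: "distinct [x, z, v]" "{x, z, v} \<subseteq> {1..6}" using d r by auto
    have "three_cycle x z v \<in> carrier (alt_group 6)"
      using dT by (intro three_cycle_in_alt_group) auto
    then have "reaches_double_transp 2 6 (three_cycle x z v)"
      using dT by (intro alt_group_6_three_cycle_reaches[of _ x z v]) (auto simp: three_cycle_def)
    moreover have "(g, three_cycle x z v) \<in> engel_edges 2 6"
      using engel_edge_to_three_cycle[OF g dT] disj by blast
    ultimately show False using reaches_double_transp_step contr2 by blast
  qed
  have "card ({1..6} - {x, y, z, w, v}) = 1"
    using d r by (simp add: card_Diff_subset card_insert_if)
  then obtain u where u: "{1..6} - {x, y, z, w, v} = {u}" by (rule card_1_singletonE)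
  then have u': "u \<in> {1..6}" "u \<notin> {x, y, z, w, v}" by blast+
  have "g u \<notin> {x, y, z, w, v}"
    using inj[of u x] inj[of u y] inj[of u z] inj[of u w] inj[of u v] it gv u'(2) by auto
  moreover have "g u \<in> {1..6}" using alt_group_in_range[OF g(1), of u] u'(1) by blast
  ultimately have "g u = u" using u by blast
  then show False
    using alt_group_6_five_cycle_reaches[OF g(1) _ _ it gv, of u] d r u' contr by auto
qed

section \<open>Elements that are never Engel-trivial, and the vertex sets of the graphs\<close>

text \<open>The condition below says that \<open>g\<close> maps some but not all points of \<open>T\<close> into \<open>T\<close>. If \<open>T\<close> is
  the support of a 3-cycle \<open>y\<close>, it passes from \<open>g\<close> to \<open>[g,y]\<close>, so no iterated commutator of \<open>g\<close>
  with \<open>y\<close> is trivial.\<close>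

definition splits :: "('a \<Rightarrow> 'a) \<Rightarrow> 'a set \<Rightarrow> bool" where
  "splits g T \<longleftrightarrow> (\<exists>a \<in> T. g a \<in> T) \<and> (\<exists>b \<in> T. g b \<notin> T)"

lemma splits_commutator:
  assumes "bij g" "distinct [p, q, r]" "splits g {p, q, r}"
  defines "y \<equiv> three_cycle p q r"
  shows "splits (inv' g \<circ> inv' y \<circ> g \<circ> y) {p, q, r}"
proof -
  define T where "T = {p, q, r}"
  define s where "s = three_cycle r q p"
  have sv: "s p = r" "s r = q" "s q = p" "\<And>x. x \<notin> T \<Longrightarrow> s x = x"
    using assms(2) by (auto simp: s_def three_cycle_def T_def)
  have yv: "y p = q" "y q = r" "y r = p" "\<And>x. x \<notin> T \<Longrightarrow> y x = x"
    using assms(2) by (auto simp: y_def three_cycle_def T_def)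
  have cases: "x = p \<or> x = q \<or> x = r \<or> x \<notin> T" for x by (auto simp: T_def)
  have ys: "y (s x) = x" for x using cases[of x] sv yv by (elim disjE) simp_all
  have sy: "s (y x) = x" for x using cases[of x] sv yv by (elim disjE) simp_all
  have "inv' y = s" by (rule inv_unique_comp) (auto simp: fun_eq_iff ys sy)
  have sT: "s x \<in> T" if "x \<in> T" for x using that sv by (auto simp: T_def)
  have ig: "inv' g (g x) = x" for x using assms(1) by (simp add: bij_is_inj inv_f_f)
  have gi: "g (inv' g x) = x" for x using assms(1) by (simp add: bij_is_surj surj_f_inv_f)
  define w where "w = inv' g \<circ> inv' y \<circ> g \<circ> y"
  have w: "w (s x) = inv' g (s (g x))" for x by (simp add: w_def \<open>inv' y = s\<close> ys)
  obtain a b where ab: "a \<in> T" "g a \<in> T" "b \<in> T" "g b \<notin> T"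
    using assms(3) by (auto simp: splits_def T_def)
  \<comment> \<open>The image of \<open>b\<close> is outside \<open>T\<close>, hence fixed by the
    inverse \<open>s\<close> of \<open>y\<close>; so \<open>w\<close> takes a point of
    \<open>T\<close> into \<open>T\<close>.\<close>
  have "w (s b) = b" using w sv(4)[OF ab(4)] ig by simp
  then have 1: "\<exists>x \<in> T. w x \<in> T" using sT ab(3) by metis
  \<comment> \<open>Otherwise the common part of \<open>T\<close> and its image is closed under
    \<open>s\<close>. As it contains the image of \<open>a\<close>, and \<open>s\<close> is
    transitive on \<open>T\<close>, the set \<open>T\<close> would equal its image, against the
    choice of \<open>b\<close>.\<close>
  have "\<exists>x \<in> T. g x \<in> T \<and> s (g x) \<notin> g ` T"
  proof (rule ccontr)
    assume "\<not> ?thesis"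
    then have cl: "s t \<in> g ` T" if "t \<in> T" "t \<in> g ` T" for t using that by blast
    have "g a \<in> T" "g a \<in> g ` T" using ab by auto
    then have "s (g a) \<in> g ` T" "s (s (g a)) \<in> g ` T" using cl sT by blast+
    then have "{g a, s (g a), s (s (g a))} \<subseteq> g ` T" using \<open>g a \<in> g ` T\<close> by simp
    moreover have "{g a, s (g a), s (s (g a))} = T"
      using \<open>g a \<in> T\<close> sv(1-3) unfolding T_def by auto
    ultimately have "T \<subseteq> g ` T" by simp
    moreover have "card (g ` T) = card T"
      using assms(1) by (intro card_image inj_on_subset[OF bij_is_inj]) auto
    ultimately have "T = g ` T" by (intro card_subset_eq) (auto simp: T_def)
    then show False using ab by blast
  qed
  then obtain x where x: "x \<in> T" "s (g x) \<notin> g ` T" by blast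
  have "w (s x) \<notin> T" using x(2) w gi by (metis imageI)
  then have 2: "\<exists>x \<in> T. w x \<notin> T" using sT x(1) by metis
  show ?thesis using 1 2 unfolding splits_def w_def T_def by blast
qed

lemma alt_group_commutator:
  assumes "x \<in> carrier (alt_group n)" "y \<in> carrier (alt_group n)"
  shows "commutator (alt_group n) x y = inv' x \<circ> inv' y \<circ> x \<circ> y"
  using assms by (simp add: commutator_def alt_group_mult alt_group_inv_equality)

lemma splits_engel_commutator:
  assumes "g \<in> carrier (alt_group n)" "distinct [p, q, r]" "{p, q, r} \<subseteq> {1..n}" "splits g {p, q, r}"
  shows "splits (engel_commutator (alt_group n) k g (three_cycle p q r)) {p, q, r}"
proof (induction k)
  case (Suc k)
  have y: "three_cycle p q r \<in> carrier (alt_group n)"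
    using assms by (intro three_cycle_in_alt_group) auto
  have "engel_commutator (alt_group n) k g (three_cycle p q r) \<in> carrier (alt_group n)"
    using engel_commutator_closed[OF alt_group_is_group assms(1) y] .
  then show ?case
    unfolding engel_commutator.simps
    by (subst alt_group_commutator[OF _ y], assumption)
      (intro splits_commutator assms(2) Suc.IH alt_group_bij)
qed (use assms in simp)

text \<open>It suffices to find three points that \<open>g\<close> splits. If p, q, g q are
  distinct, take p, q and a point avoiding g q. If \<open>g\<close> swaps p and q, take p, q and a
  third point r when r is moved; when r is fixed, take p, r and a fourth point, so that p leaves the
  set while r stays.\<close>

lemma alt_group_not_engel:
  assumes g: "g \<in> carrier (alt_group n)" "g \<noteq> id" and n: "n \<ge> 4"
  obtains y where "y \<in> carrier (alt_group n)" "\<And>k. engel_commutator (alt_group n) k g y \<noteq> id"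
proof -
  note inj = alt_group_inj_eq[OF g(1)]
  obtain p where p: "g p \<noteq> p" using g(2) by (auto simp: fun_eq_iff)
  define q where "q = g p"
  have pq: "p \<in> {1..n}" "q \<in> {1..n}" "p \<noteq> q"
    using alt_group_moved[OF g(1) p] alt_group_in_range[OF g(1), of p] p by (auto simp: q_def)
  have extra: "\<exists>r \<in> {1..n}. r \<notin> {a, b, c}" for a b c
  proof (rule ccontr)
    assume "\<not> ?thesis"
    then have "{1..n} \<subseteq> {a, b, c}" by blast
    from card_mono[OF _ this] have "n \<le> card {a, b, c}" by simp
    also have "\<dots> \<le> 3" by (simp add: card_insert_if)
    finally show False using n by simp
  qed
  have "\<exists>a b c. distinct [a, b, c] \<and> {a, b, c} \<subseteq> {1..n} \<and> splits g {a, b, c}"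
  proof (cases "g q = p")
    case False
    obtain r where r: "r \<in> {1..n}" "r \<notin> {p, q, g q}" using extra[of p q "g q"] by blast
    have "g q \<noteq> q" using inj[of q p] pq by (simp add: q_def)
    then have "g q \<notin> {p, q, r}" using False r by auto
    then have "splits g {p, q, r}" unfolding splits_def by (auto simp: q_def)
    then show ?thesis using pq r by (intro exI[of _ p] exI[of _ q] exI[of _ r]) auto
  next
    case True
    obtain r where r: "r \<in> {1..n}" "r \<notin> {p, q}" using extra[of p q q] by blast
    show ?thesis
    proof (cases "g r = r")
      case False
      have "g r \<notin> {p, q, r}" using False inj[of r q] inj[of r p] True r by (auto simp: q_def)
      then have "splits g {p, q, r}" unfolding splits_def by (auto simp: q_def)
      then show ?thesis using pq r by (intro exI[of _ p] exI[of _ q] exI[of _ r]) auto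
    next
      case True
      obtain s where s: "s \<in> {1..n}" "s \<notin> {p, q, r}"
        using extra[of p q r] by blast
      have "g p \<notin> {p, r, s}" using r s pq by (auto simp: q_def)
      then have "splits g {p, r, s}" unfolding splits_def using True by auto
      then show ?thesis using pq r s by (intro exI[of _ p] exI[of _ r] exI[of _ s]) auto
    qed
  qed
  then obtain a b c where abc: "distinct [a, b, c]" "{a, b, c} \<subseteq> {1..n}" "splits g {a, b, c}" by blast
  have y: "three_cycle a b c \<in> carrier (alt_group n)"
    using abc by (intro three_cycle_in_alt_group) auto
  have "engel_commutator (alt_group n) k g (three_cycle a b c) \<noteq> id" for k
    using splits_engel_commutator[OF g(1) abc, of k] by (auto simp: splits_def)
  then show ?thesis using that y by blast
qed

lemma engel_universal_alt_group:
  assumes "n \<ge> 4" "k \<ge> 1"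
  shows "engel_universal k (alt_group n) = {id}"
proof -
  interpret group "alt_group n" by (rule alt_group_is_group)
  have "g = id" if "g \<in> engel_universal k (alt_group n)" for g
    using alt_group_not_engel[of g n] assms that unfolding engel_universal_def alt_group_one by blast
  moreover have "id \<in> engel_universal k (alt_group n)"
  proof -
    have "engel_commutator (alt_group n) k x \<one>\<^bsub>alt_group n\<^esub> = \<one>\<^bsub>alt_group n\<^esub>"
      if "x \<in> carrier (alt_group n)" for x
      using engel_commutator_mono[OF alt_group_is_group one_closed, of 1 x k] that assms(2)
      by (simp add: commutator_def)
    moreover have "engel_commutator (alt_group n) k \<one>\<^bsub>alt_group n\<^esub> x = \<one>\<^bsub>alt_group n\<^esub>"
      if "x \<in> carrier (alt_group n)" for x
      using engel_commutator_one[OF alt_group_is_group that] .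
    ultimately have "\<one>\<^bsub>alt_group n\<^esub> \<in> engel_universal k (alt_group n)"
      by (simp add: engel_universal_def)
    then show ?thesis by (simp only: alt_group_one)
  qed
  ultimately show ?thesis by blast
qed

text \<open>The elements of the quotient by the trivial subgroup are singletons, so its center is
  trivial like that of the group, and the series never grows.\<close>

lemma (in group) upper_central_trivial:
  assumes "group_center G = {\<one>}"
  shows "upper_central G i = {\<one>}"
proof (induction i)
  case (Suc i)
  have coset: "{\<one>} #> x = {x}" if "x \<in> carrier G" for x
    using that by (simp add: r_coset_def)
  have "x = \<one>" if x: "x \<in> carrier G" "{x} \<in> group_center (G Mod {\<one>})" for x
  proof -
    have "x \<otimes> g = g \<otimes> x" if g: "g \<in> carrier G" for g
    proof -
      have "{g} \<in> carrier (G Mod {\<one>})"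
        using coset[OF g] g by (auto simp: FactGroup_def RCOSETS_def)
      then have "{x} <#> {g} = {g} <#> {x}"
        using x(2) by (auto simp: group_center_def FactGroup_def)
      then show ?thesis by (simp add: set_mult_def)
    qed
    then have "x \<in> group_center G" using x(1) by (simp add: group_center_def)
    then show ?thesis using assms by simp
  qed
  moreover have "{\<one>} \<in> group_center (G Mod {\<one>})"
  proof -
    have "{\<one>} <#> H = H <#> {\<one>}" if H: "H \<in> rcosets {\<one>}" for H
    proof -
      obtain g where "g \<in> carrier G" "H = {\<one>} #> g" using H by (auto simp: RCOSETS_def)
      with coset have "g \<in> carrier G" "H = {g}" by simp_all
      then show ?thesis by (simp add: set_mult_def)
    qed
    moreover have "{\<one>} \<in> rcosets {\<one>}" using coset[of \<one>] unfolding RCOSETS_def by blast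
    ultimately show ?thesis by (simp add: group_center_def FactGroup_def)
  qed
  ultimately show ?case using Suc.IH coset by auto
qed simp

lemma hypercenter_alt_group:
  assumes "n \<ge> 4"
  shows "hypercenter (alt_group n) = {id}"
proof -
  interpret group "alt_group n" by (rule alt_group_is_group)
  have "g = \<one>\<^bsub>alt_group n\<^esub>" if g: "g \<in> group_center (alt_group n)" for g
  proof (rule ccontr)
    assume "g \<noteq> \<one>\<^bsub>alt_group n\<^esub>"
    moreover have gc: "g \<in> carrier (alt_group n)" using g by (simp add: group_center_def)
    ultimately obtain y where y: "y \<in> carrier (alt_group n)" "\<And>k. engel_commutator (alt_group n) k g y \<noteq> id"
      using alt_group_not_engel[of g n] assms unfolding alt_group_one by blast
    have "g \<otimes>\<^bsub>alt_group n\<^esub> y = y \<otimes>\<^bsub>alt_group n\<^esub> g" using g y(1) by (simp add: group_center_def)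
    then have "commutator (alt_group n) g y = \<one>\<^bsub>alt_group n\<^esub>"
      using commutator_commute[OF alt_group_is_group gc y(1)] by blast
    then have "engel_commutator (alt_group n) 1 g y = id" by (simp add: alt_group_one)
    then show False using y(2) by blast
  qed
  moreover have "\<one>\<^bsub>alt_group n\<^esub> \<in> group_center (alt_group n)" by (simp add: group_center_def)
  ultimately have "group_center (alt_group n) = {\<one>\<^bsub>alt_group n\<^esub>}" by blast
  from upper_central_trivial[OF this] show ?thesis
    unfolding hypercenter_def by (simp add: alt_group_one)
qed

section \<open>Permutations as lists, and the finite checks in degrees 5 and 6\<close>

text \<open>A permutation \<open>p\<close> of \<open>{1..n}\<close> is encoded by the list \<open>[p 1, \<dots>, p n]\<close>. The second argument
  of \<open>perm_lists\<close> selects the even or the odd permutations; a permutation of \<open>{1..Suc n}\<close> is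
  \<open>transpose (Suc n) b \<circ> p\<close> with \<open>p\<close> a permutation of \<open>{1..n}\<close>.\<close>

fun perm_lists :: "nat \<Rightarrow> bool \<Rightarrow> nat list list" where
  "perm_lists 0 e = (if e then [[]] else [])"
| "perm_lists (Suc n) e = map (\<lambda>l. l @ [Suc n]) (perm_lists n e) @
     concat (map (\<lambda>b. map (\<lambda>l. map (\<lambda>x. if x = b then Suc n else x) l @ [b]) (perm_lists n (\<not> e)))
       [1..<Suc n])"

definition to_list :: "nat \<Rightarrow> (nat \<Rightarrow> nat) \<Rightarrow> nat list" where
  "to_list n p = map p [1..<Suc n]"

text \<open>Points are counted from 1 and list positions from 0, hence the shift.\<close>

definition list_comp :: "nat list \<Rightarrow> nat list \<Rightarrow> nat list" where
  "list_comp l m = map (\<lambda>i. l ! (i - 1)) m"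

definition list_inv :: "nat list \<Rightarrow> nat list" where
  "list_inv l = map (\<lambda>i. hd (filter (\<lambda>j. l ! (j - 1) = i) [1..<Suc (length l)])) [1..<Suc (length l)]"

lemma to_list_in_perm_lists:
  "p permutes {1..n} \<Longrightarrow> to_list n p \<in> set (perm_lists n (evenperm p))"
proof (induction n arbitrary: p)
  case 0
  then show ?case by (simp add: to_list_def)
next
  case (Suc n)
  have ins: "{1..Suc n} = insert (Suc n) {1..n}" by auto
  define b where "b = p (Suc n)"
  define q where "q = transpose (Suc n) b \<circ> p"
  have q: "q permutes {1..n}"
    using permutes_insert_lemma[of p "Suc n" "{1..n}"] Suc.prems unfolding ins q_def b_def .
  have p: "p = transpose (Suc n) b \<circ> q" by (simp add: q_def fun_eq_iff)
  have "permutation q" using q permutes_imp_permutation by blast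
  then have ev: "evenperm p \<longleftrightarrow> (b = Suc n) = evenperm q"
    unfolding p by (auto simp: evenperm_comp permutation_swap_id evenperm_swap)
  have qn: "q (Suc n) = Suc n" using permutes_not_in[OF q] by simp
  have qr: "q i \<noteq> Suc n" if "i \<in> {1..n}" for i
    using permutes_in_image[OF q, of i] that by auto
  have upt: "[1..<Suc (Suc n)] = [1..<Suc n] @ [Suc n]" by simp
  have IH: "to_list n q \<in> set (perm_lists n (evenperm q))" using Suc.IH[OF q] .
  have "b \<in> {1..Suc n}" using permutes_in_image[OF Suc.prems, of "Suc n"] by (simp add: b_def)
  then consider "b = Suc n" | "b \<in> {1..n}" "b \<noteq> Suc n" by fastforce
  then show ?case
  proof cases
    case 1
    then have "p = q" using p by simp
    then have "to_list (Suc n) p = to_list n q @ [Suc n]"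
      using qn unfolding to_list_def upt by simp
    then show ?thesis using IH \<open>p = q\<close> by auto
  next
    case 2
    \<comment> \<open>Here composing with the transposition turns the value \<open>b\<close> of
      \<open>q\<close> into \<open>Suc n\<close>, sends \<open>Suc n\<close> to \<open>b\<close>,
      and flips the parity.\<close>
    have "to_list (Suc n) p = map (\<lambda>x. if x = b then Suc n else x) (to_list n q) @ [b]"
      using qn qr unfolding to_list_def upt p by (auto simp: transpose_def)
    moreover have "evenperm q = (\<not> evenperm p)" using ev 2 by auto
    ultimately show ?thesis using IH 2(1) by (auto simp del: upt.simps)
  qed
qed

lemma to_list_nth:
  assumes "i \<in> {1..n}"
  shows "to_list n p ! (i - 1) = p i"
proof -
  obtain k where "i = Suc k" "k < n" using assms by (cases i) auto
  then show ?thesis by (simp add: to_list_def del: upt.simps)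
qed

lemma to_list_comp:
  assumes "q permutes {1..n}"
  shows "to_list n (p \<circ> q) = list_comp (to_list n p) (to_list n q)"
proof -
  have "to_list n p ! (q i - 1) = p (q i)" if "i \<in> {1..n}" for i
    using to_list_nth permutes_in_image[OF assms] that by blast
  then show ?thesis by (auto simp: to_list_def list_comp_def simp del: upt.simps)
qed

lemma to_list_inv:
  assumes "p permutes {1..n}"
  shows "to_list n (inv' p) = list_inv (to_list n p)"
proof -
  have len: "length (to_list n p) = n" by (simp add: to_list_def)
  note nth = to_list_nth[of _ n p]
  have "inv' p i = hd (filter (\<lambda>j. to_list n p ! (j - 1) = i) [1..<Suc n])" if i: "i \<in> {1..n}" for i
  proof -
    let ?xs = "filter (\<lambda>j. to_list n p ! (j - 1) = i) [1..<Suc n]"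
    have "inv' p i \<in> {1..n}" using permutes_in_image[OF permutes_inv[OF assms]] i by blast
    then have "inv' p i \<in> set ?xs" using nth permutes_inverses(1)[OF assms] by (auto simp del: upt.simps)
    then have "hd ?xs \<in> set ?xs" by (metis hd_in_set list.set_cases list.distinct(1))
    then have "hd ?xs \<in> {1..n}" "p (hd ?xs) = i" using nth by (auto simp del: upt.simps)
    then show ?thesis using permutes_inverses(2)[OF assms] by metis
  qed
  then show ?thesis unfolding list_inv_def len by (auto simp: to_list_def simp del: upt.simps)
qed

lemma to_list_inject:
  assumes "p permutes {1..n}" "q permutes {1..n}" "to_list n p = to_list n q"
  shows "p = q"
proof
  fix i
  show "p i = q i"
    using assms permutes_not_in[OF assms(1), of i] permutes_not_in[OF assms(2), of i]
    by (cases "i \<in> {1..n}") (auto simp: to_list_def simp del: upt.simps)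
qed

text \<open>These are c, c^2, c^3, c^4 for c = (1 2 3 4 5) with 6 fixed. In this order, zipping with
  the reversed list pairs each power with its inverse.\<close>

definition five_cycle_powers :: "nat list list" where
  "five_cycle_powers = [[2,3,4,5,1,6], [3,4,5,1,2,6], [4,5,1,2,3,6], [5,1,2,3,4,6]]"

definition five_cycle_check :: bool where
  "five_cycle_check \<longleftrightarrow> list_all (\<lambda>(x, xi). list_all (\<lambda>y. (\<lambda>y'.
     if list_comp y y' = list_comp y' y then y = [1,2,3,4,5,6] \<or> y \<in> set five_cycle_powers else True)
       (list_comp x (list_comp y xi))) (perm_lists 6 True))
     (zip five_cycle_powers (rev five_cycle_powers))"

text \<open>Element orders in the alternating group of degree 5 are 1, 2, 3 and 5, so the tests on
  squares and cubes say exactly that \<open>y\<close> and \<open>z\<close> have the same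
  order.\<close>

definition commute_check :: bool where
  "commute_check \<longleftrightarrow> list_all (\<lambda>z. (\<lambda>zi. list_all (\<lambda>y. (\<lambda>y'.
     if list_comp y y' = list_comp y' y then
       if (list_comp z z = [1,2,3,4,5]) = (list_comp y y = [1,2,3,4,5]) then
         if (list_comp z (list_comp z z) = [1,2,3,4,5]) = (list_comp y (list_comp y y) = [1,2,3,4,5]) then
           list_comp z y = list_comp y z
         else True
       else True
     else True) (list_comp z (list_comp y zi))) (perm_lists 5 True)) (list_inv z)) (perm_lists 5 True)"

lemma five_cycle_check: five_cycle_check
  by code_simp

lemma commute_check: commute_check
  by code_simp

section \<open>Strong connectedness from paths through double transpositions\<close>

lemma strongly_connected_of_edges:
  assumes "n \<ge> 6" "k \<ge> 2" "\<And>g. g \<in> carrier (alt_group n) \<Longrightarrow> g \<noteq> id \<Longrightarrow> reaches_double_transp k n g"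
    and V: "pverts H = carrier (alt_group n) - {id}" and E: "engel_edges k n \<subseteq> parcs H"
  shows "strongly_connected (with_proj H)"
proof -
  \<comment> \<open>Strong connectedness includes that there is a vertex.\<close>
  have dt: "double_transp 1 2 3 4 \<in> pverts H"
    using assms(1) double_transp_neq_id[of "1::nat" 2 3 4] double_transp_in_alt_group[of 1 2 3 4 n]
    unfolding V by auto
  have reach: "(g, h) \<in> (engel_edges k n)\<^sup>*" if gV: "g \<in> pverts H" and hV: "h \<in> pverts H" for g h
  proof -
    obtain a b c d where "distinct [a, b, c, d]" "{a, b, c, d} \<subseteq> {1..n}"
      "(g, double_transp a b c d) \<in> (engel_edges k n)\<^sup>*"
      using assms(3)[of g] gV unfolding V reaches_double_transp_def by blast
    moreover have "(double_transp a b c d, h) \<in> (engel_edges 2 n)\<^sup>*"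
      using double_transp_reaches_all[of h n a b c d] calculation(1,2) hV assms(1) unfolding V by blast
    then have "(double_transp a b c d, h) \<in> (engel_edges k n)\<^sup>*"
      using rtrancl_mono[OF engel_edges_mono[OF assms(2)]] by blast
    ultimately show ?thesis by (meson rtrancl_trans)
  qed
  have "h \<in> pverts H \<and> (g, h) \<in> rtrancl_on (pverts H) (parcs H)"
    if "(g, h) \<in> (engel_edges k n)\<^sup>*" "g \<in> pverts H" for g h
    using that
  proof (induction rule: rtrancl_induct)
    case (step y z)
    have "z \<in> pverts H" using step.hyps(2) unfolding V engel_edges_def by blast
    then show ?case using step E by (meson rtrancl_on_into_rtrancl_on subsetD)
  qed simp
  with reach dt show ?thesis
    unfolding strongly_connected_def reachable_def with_proj_simps by blast
qed

lemma reachable_closed: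
  assumes "u \<rightarrow>\<^sup>*\<^bsub>with_proj H\<^esub> v" "u \<in> S" "\<And>x y. x \<in> S \<Longrightarrow> (x, y) \<in> parcs H \<Longrightarrow> y \<in> S"
  shows "v \<in> S"
  using assms(1) unfolding reachable_def with_proj_simps
  by (induction rule: rtrancl_on_induct) (use assms in blast)+

section \<open>Engel edges in degree 5 and the trap of 5-cycles\<close>

text \<open>In \<open>A\<^sub>5\<close> a 3-Engel edge is already a 2-Engel edge, because \<open>[w,y] = z y\<close> for a
  conjugate \<open>z\<close> of the inverse of \<open>y\<close>; the orders of \<open>y\<close> and \<open>z\<close> then agree.\<close>

lemma alt_group_5_commute:
  assumes y: "y \<in> carrier (alt_group 5)" and z: "z \<in> carrier (alt_group 5)"
    and y': "y' \<circ> z = z \<circ> y" "y \<circ> y' = y' \<circ> y"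
    and ord: "z \<circ> z = id \<longleftrightarrow> y \<circ> y = id" "z \<circ> (z \<circ> z) = id \<longleftrightarrow> y \<circ> (y \<circ> y) = id"
  shows "z \<circ> y = y \<circ> z"
proof -
  let ?L = "to_list 5"
  have yp: "y permutes {1..5}" "evenperm y" and zp: "z permutes {1..5}" "evenperm z"
    using y z by (simp_all add: alt_group_carrier)
  have "z \<circ> y \<circ> inv' z = y' \<circ> (z \<circ> inv' z)" unfolding y'(1) [symmetric] by (simp add: comp_assoc)
  then have y'_eq: "y' = z \<circ> (y \<circ> inv' z)"
    using permutes_inv_o(1)[OF zp(1)] by (simp add: comp_assoc)
  have y'p: "y' permutes {1..5}"
    unfolding y'_eq by (intro permutes_compose permutes_inv yp zp)
  have idL: "?L p = [1,2,3,4,5] \<longleftrightarrow> p = id" if "p permutes {1..5}" for p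
  proof -
    have "?L id = [1,2,3,4,5]" by (simp add: to_list_def upt_rec)
    then show ?thesis using to_list_inject[OF that permutes_id] by metis
  qed
  note comp = to_list_comp[of _ 5]
  have lists: "?L y \<in> set (perm_lists 5 True)" "?L z \<in> set (perm_lists 5 True)"
    using to_list_in_perm_lists[OF yp(1)] to_list_in_perm_lists[OF zp(1)] yp zp by simp_all
  have Ly': "?L y' = list_comp (?L z) (list_comp (?L y) (list_inv (?L z)))"
    unfolding y'_eq by (simp only: comp to_list_inv permutes_compose permutes_inv yp zp)
  have "list_comp (?L y) (?L y') = list_comp (?L y') (?L y)"
    using y'(2) comp[OF y'p, of y] comp[OF yp(1), of y'] by simp
  moreover have "(list_comp (?L z) (?L z) = [1,2,3,4,5]) = (list_comp (?L y) (?L y) = [1,2,3,4,5])"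
    using ord(1) idL[OF permutes_compose[OF zp(1) zp(1)]] idL[OF permutes_compose[OF yp(1) yp(1)]]
    by (simp only: comp yp zp)
  moreover have "(list_comp (?L z) (list_comp (?L z) (?L z)) = [1,2,3,4,5]) =
      (list_comp (?L y) (list_comp (?L y) (?L y)) = [1,2,3,4,5])"
    using ord(2) idL[OF permutes_compose[OF permutes_compose[OF zp(1) zp(1)] zp(1)]]
      idL[OF permutes_compose[OF permutes_compose[OF yp(1) yp(1)] yp(1)]]
    by (simp only: comp yp zp permutes_compose)
  ultimately have "list_comp (?L z) (?L y) = list_comp (?L y) (?L z)"
    using commute_check[unfolded commute_check_def list_all_iff, rule_format, OF lists(2,1)]
    unfolding Ly' by (simp only: if_True simp_thms)
  then have "?L (z \<circ> y) = ?L (y \<circ> z)" by (simp only: comp yp zp)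
  then show ?thesis
    by (intro to_list_inject[of _ 5] permutes_compose yp zp)
qed

text \<open>The number of commutators is lowered one at a time: the induction hypothesis for [w,y]
  shows that three commutators suffice for \<open>w\<close>, and the case of three reduces to
  two.\<close>

lemma alt_group_5_engel_2:
  assumes x: "x \<in> carrier (alt_group 5)" and y: "y \<in> carrier (alt_group 5)"
    and "engel_commutator (alt_group 5) k x y = id"
  shows "engel_commutator (alt_group 5) 2 x y = id"
proof -
  interpret group "alt_group 5" by (rule alt_group_is_group)
  note [simp] = alt_group_mult alt_group_one
  have three: "engel_commutator (alt_group 5) 2 w y = id"
    if w: "w \<in> carrier (alt_group 5)" and e: "engel_commutator (alt_group 5) 3 w y = id" for w
  proof -
    define z where "z = inv' w \<circ> inv' y \<circ> w"
    have zc: "z \<in> carrier (alt_group 5)"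
      unfolding z_def by (intro alt_group_comp_closed alt_group_inv_closed w y)
    have cw: "commutator (alt_group 5) w y = z \<circ> y"
      using w y by (simp add: alt_group_commutator z_def)
    have zy: "z \<circ> y \<in> carrier (alt_group 5)" by (intro alt_group_comp_closed zc y)
    \<comment> \<open>As \<open>y\<close> commutes with itself, \<open>y'\<close> is also the
      conjugate of \<open>y\<close> by [w,y] = z y, so the vanishing of two more commutators makes
      \<open>y\<close> and \<open>y'\<close> commute.\<close>
    define y' where "y' = z \<circ> y \<circ> inv' z"
    have y'c: "y' \<in> carrier (alt_group 5)"
      unfolding y'_def by (intro alt_group_comp_closed alt_group_inv_closed zc y)
    have invz: "inv' z \<circ> z = id" using alt_group_bij[OF zc] by (simp add: bij_is_inj)
    have y'z: "y' \<circ> z = z \<circ> y" unfolding y'_def comp_assoc invz by simp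
    have "engel_commutator (alt_group 5) 2 (z \<circ> y) y = id"
      using engel_commutator_add[of "alt_group 5" 2 1 w y] e cw by (simp add: numeral_3_eq_3 numeral_2_eq_2)
    moreover have "y' \<circ> (z \<circ> y) = (z \<circ> y) \<circ> y" using y'z by (metis comp_assoc)
    ultimately have yy': "y \<circ> y' = y' \<circ> y"
      using engel2_iff[OF alt_group_is_group zy y y'c] by simp
    have "z \<circ> y = y \<circ> z"
    proof (rule alt_group_5_commute[OF y zc y'z yy'])
      have iw: "w (inv' w a) = a" "inv' w (w a) = a" for a
        using alt_group_bij[OF w] by (simp_all add: bij_is_surj surj_f_inv_f bij_is_inj)
      have iy: "y (inv' y a) = a" "inv' y (y a) = a" for a
        using alt_group_bij[OF y] by (simp_all add: bij_is_surj surj_f_inv_f bij_is_inj)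
      have z: "z a = inv' w (inv' y (w a))" for a by (simp add: z_def)
      show "z \<circ> z = id \<longleftrightarrow> y \<circ> y = id"
        unfolding fun_eq_iff o_apply id_apply z iw by (metis iw iy)
      show "z \<circ> (z \<circ> z) = id \<longleftrightarrow> y \<circ> (y \<circ> y) = id"
        unfolding fun_eq_iff o_apply id_apply z iw by (metis iw iy)
    qed
    then have "commutator (alt_group 5) (z \<circ> y) y = id"
      using commutator_commute[OF alt_group_is_group zy y] by (simp add: comp_assoc)
    then show ?thesis using cw by (simp add: numeral_2_eq_2)
  qed
  have "engel_commutator (alt_group 5) 2 w y = id"
    if "w \<in> carrier (alt_group 5)" "engel_commutator (alt_group 5) (2 + j) w y = id" for j w
    using that
  proof (induction j arbitrary: w)
    case (Suc j)
    have w': "engel_commutator (alt_group 5) 1 w y \<in> carrier (alt_group 5)"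
      using engel_commutator_closed[OF alt_group_is_group Suc.prems(1) y] .
    have "engel_commutator (alt_group 5) (2 + j) (engel_commutator (alt_group 5) 1 w y) y = id"
      using Suc.prems(2) unfolding engel_commutator_add [symmetric] by (simp only: add_Suc_right One_nat_def add_0_right)
    from Suc.IH[OF w' this] have "engel_commutator (alt_group 5) (2 + 1) w y = id"
      using engel_commutator_add[of "alt_group 5" 2 1 w y] by (simp add: id_def)
    then show ?case using three[OF Suc.prems(1)] by simp
  qed simp
  from this[of x k] show ?thesis
    using x engel_commutator_mono[OF alt_group_is_group y, of k x "2 + k"] assms(3) by simp
qed

text \<open>This is (1 2 3 4 5), factored into 3-cycles to make its evenness evident.\<close>

definition five_cycle :: "nat \<Rightarrow> nat" where
  "five_cycle = three_cycle 1 2 3 \<circ> three_cycle 3 4 5"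

lemma five_cycle_in_alt_group: "n \<ge> 5 \<Longrightarrow> five_cycle \<in> carrier (alt_group n)"
  unfolding five_cycle_def by (intro alt_group_comp_closed three_cycle_in_alt_group) auto

text \<open>A nontrivial power \<open>x\<close> of the 5-cycle has 2-Engel edges only to such powers, so these form
  a trap in the graph.\<close>

lemma five_cycle_trap:
  assumes "x \<in> carrier (alt_group 6)" "to_list 6 x \<in> set five_cycle_powers"
    "y \<in> carrier (alt_group 6)" "y \<noteq> id" "y' \<circ> x = x \<circ> y" "y \<circ> y' = y' \<circ> y"
  shows "to_list 6 y \<in> set five_cycle_powers"
proof -
  let ?L = "to_list 6"
  have xp: "x permutes {1..6}" and yp: "y permutes {1..6}" "evenperm y"
    using assms by (simp_all add: alt_group_carrier)
  have y'_eq: "y' = x \<circ> (y \<circ> inv' x)"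
  proof -
    have "x \<circ> y \<circ> inv' x = y' \<circ> (x \<circ> inv' x)" unfolding assms(5) [symmetric] by (simp add: comp_assoc)
    then show ?thesis using permutes_inv_o(1)[OF xp] by (simp add: comp_assoc)
  qed
  have y'p: "y' permutes {1..6}"
    unfolding y'_eq by (intro permutes_compose permutes_inv yp xp)
  note comp = to_list_comp[of _ 6]
  have Ly': "?L y' = list_comp (?L x) (list_comp (?L y) (list_inv (?L x)))"
    unfolding y'_eq by (simp only: comp to_list_inv permutes_compose permutes_inv yp xp)
  have "\<forall>l \<in> set five_cycle_powers. (l, list_inv l) \<in> set (zip five_cycle_powers (rev five_cycle_powers))"
    by code_simp
  then have "(?L x, list_inv (?L x)) \<in> set (zip five_cycle_powers (rev five_cycle_powers))"
    using assms(2) by blast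
  note zip = this
  have yL: "?L y \<in> set (perm_lists 6 True)"
    using to_list_in_perm_lists[OF yp(1)] yp by simp
  have "list_comp (?L y) (?L y') = list_comp (?L y') (?L y)"
    using assms(6) comp[OF y'p, of y] comp[OF yp(1), of y'] by simp
  then have "?L y = [1,2,3,4,5,6] \<or> ?L y \<in> set five_cycle_powers"
    using five_cycle_check [unfolded five_cycle_check_def list_all_iff, rule_format,
        of "(?L x, list_inv (?L x))", unfolded prod.case, rule_format, OF zip yL]
    unfolding Ly' by (simp only: if_True simp_thms)
  moreover have "?L id = [1,2,3,4,5,6]" by (simp add: to_list_def upt_rec)
  ultimately show ?thesis using to_list_inject[OF yp(1) permutes_id] assms(4) by metis
qed

text \<open>Permutations of degree 5 are regarded as fixing 6, so the check in degree 6 covers both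
  degrees. The trap contains the 5-cycle but not (1 2)(3 4).\<close>

lemma not_strongly_connected_five_cycle:
  assumes n: "n = 5 \<or> n = 6"
    and V: "pverts H = carrier (alt_group n) - {id}"
    and E: "\<And>x y. (x, y) \<in> parcs H \<Longrightarrow> (x, y) \<in> engel_edges 2 n"
  shows "\<not> strongly_connected (with_proj H)"
proof
  assume sc: "strongly_connected (with_proj H)"
  have sub: "x \<in> carrier (alt_group 6)" if "x \<in> carrier (alt_group n)" for x
    using that n permutes_subset[of x "{1..n}" "{1..6}"] by (auto simp: alt_group_carrier)
  define D where "D = double_transp (1::nat) 2 3 4"
  have L: "to_list 6 five_cycle = [2,3,4,5,1,6]" "to_list 6 D = [2,1,4,3,5,6]"
    by (simp_all add: to_list_def upt_rec five_cycle_def three_cycle_def D_def double_transp_def transpose_def)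
  have Lid: "to_list 6 id = [1,2,3,4,5,6]" by (simp add: to_list_def upt_rec)
  have c: "five_cycle \<in> pverts H"
    using five_cycle_in_alt_group[of n] n L Lid unfolding V by auto
  have "D \<in> carrier (alt_group n)"
    unfolding D_def using n by (intro double_transp_in_alt_group) auto
  then have D: "D \<in> pverts H"
    using L Lid unfolding V by auto
  have closed: "to_list 6 y \<in> set five_cycle_powers"
    if "to_list 6 x \<in> set five_cycle_powers" "(x, y) \<in> parcs H" for x y
  proof -
    have e: "(x, y) \<in> engel_edges 2 n" using E that(2) .
    then have xy: "x \<in> carrier (alt_group n)" "y \<in> carrier (alt_group n)" "y \<noteq> id"
      by (auto simp: engel_edges_def)
    define y' where "y' = x \<circ> y \<circ> inv' x"
    have "inv' x \<circ> x = id" using alt_group_bij[OF xy(1)] by (simp add: bij_is_inj)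
    then have y': "y' \<circ> x = x \<circ> y" unfolding y'_def comp_assoc by simp
    show ?thesis
      using five_cycle_trap[OF sub[OF xy(1)] that(1) sub[OF xy(2)] xy(3) y'] engel_edges_2D[OF e y']
      by blast
  qed
  have "five_cycle \<rightarrow>\<^sup>*\<^bsub>with_proj H\<^esub> D"
    using sc c D unfolding strongly_connected_def by simp
  from reachable_closed[OF this, of "{x. to_list 6 x \<in> set five_cycle_powers}"]
  have "to_list 6 D \<in> set five_cycle_powers"
    using closed L(1) by (simp add: five_cycle_powers_def)
  then show False using L(2) by (simp add: five_cycle_powers_def)
qed

theorem theorem5p2:
  fixes n :: nat
  assumes "n \<ge> 5"
  shows "(strongly_connected (with_proj (engel_graph (alt_group n))) \<longleftrightarrow> n \<noteq> 5) \<and>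
    (n \<ge> 7 \<longrightarrow> strongly_connected (with_proj (n_engel_graph 2 (alt_group n)))) \<and>
    strongly_connected (with_proj (n_engel_graph 3 (alt_group 6))) \<and>
    \<not> strongly_connected (with_proj (n_engel_graph 2 (alt_group 6)))"
proof -
  have engel: "pverts (engel_graph (alt_group n)) = carrier (alt_group n) - {id}"
    using hypercenter_alt_group[of n] assms by (simp add: engel_graph_def)
  have n_engel: "pverts (n_engel_graph k (alt_group m)) = carrier (alt_group m) - {id}"
    "parcs (n_engel_graph k (alt_group m)) = engel_edges k m" if "m \<ge> 4" "k \<ge> 1" for k m
    using engel_universal_alt_group[OF that]
    by (auto simp: n_engel_graph_def engel_edges_def alt_group_one)
  have sub: "engel_edges k n \<subseteq> parcs (engel_graph (alt_group n))" if "k \<ge> 1" for k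
  proof
    fix e assume "e \<in> engel_edges k n"
    moreover have "0 < k" using that by simp
    ultimately show "e \<in> parcs (engel_graph (alt_group n))"
      using hypercenter_alt_group[of n] assms
      unfolding engel_graph_def engel_edges_def alt_group_one by auto
  qed
  have five: "\<not> strongly_connected (with_proj (engel_graph (alt_group 5)))"
  proof (rule not_strongly_connected_five_cycle)
    show "pverts (engel_graph (alt_group 5)) = carrier (alt_group 5) - {id}"
      using hypercenter_alt_group[of 5] by (simp add: engel_graph_def)
    fix x y assume "(x, y) \<in> parcs (engel_graph (alt_group 5))"
    then show "(x, y) \<in> engel_edges 2 5"
      using hypercenter_alt_group[of 5] alt_group_5_engel_2[of x y]
      by (auto simp: engel_graph_def engel_edges_def alt_group_one)
  qed simp
  \<comment> \<open>The 3-Engel edges are used here, since 2-Engel edges cannot leave the trap of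
    5-cycles.\<close>
  have six: "strongly_connected (with_proj (engel_graph (alt_group n)))" if "n = 6"
    using strongly_connected_of_edges[of n 3] alt_group_6_reaches_double_transp that engel sub[of 3] by simp
  have seven: "strongly_connected (with_proj (engel_graph (alt_group n)))" if "n \<ge> 7"
    using strongly_connected_of_edges[of n 2] alt_group_reaches_double_transp that engel sub[of 2] by simp
  have "strongly_connected (with_proj (engel_graph (alt_group n))) \<longleftrightarrow> n \<noteq> 5"
  proof (cases "n = 5")
    case False
    then have "n = 6 \<or> n \<ge> 7" using assms by linarith
    then show ?thesis using six seven False by blast
  qed (use five in simp)
  moreover have "strongly_connected (with_proj (n_engel_graph 2 (alt_group n)))" if "n \<ge> 7"
    using strongly_connected_of_edges[of n 2] alt_group_reaches_double_transp that n_engel[of n 2] by simp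
  moreover have "strongly_connected (with_proj (n_engel_graph 3 (alt_group 6)))"
    using strongly_connected_of_edges[of 6 3] alt_group_6_reaches_double_transp n_engel[of 6 3] by simp
  moreover have "\<not> strongly_connected (with_proj (n_engel_graph 2 (alt_group 6)))"
    using not_strongly_connected_five_cycle[of 6 "n_engel_graph 2 (alt_group 6)"] n_engel[of 6 2] by simp
  ultimately show ?thesis by blast
qed

end
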